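(* Let $p$ be an odd prime, $n\ge4$, $2\le m\le n-2$, $r=n-m$, and let $I$ be the saturated generalized order ideal of $\mathbb{GH}(m,n)$ in which every element of $[n]$ has multiplicity $p-1$. Let $f:\mathbb{F}_p^n\to\mathbb{F}_p$ be the characteristic function of $I(\mathbb{GP})\setminus\{0\}$ (saturated notion) and \[ \mathcal{C}_f=\{c(s,u)=(sf(x)+u\cdot x)_{x\in\mathbb{F}_p^n\setminus0}:\ s\in\mathbb{F}_p,\ u\in\mathbb{F}_p^n\}. \] Then $\mathcal{C}_f$ is a minimal $[p^n-1,\ n+1,\ p^m+p^r-2]$ code over $\mathbb{F}_p$ with at most seven nonzero weights, it violates the Ashikhmin--Barg condition, and its weight distribution is, with $Q=(p-1)p^{n-1}$ (frequencies being added for rows with equal weight), \[ \begin{array}{ll} \text{weight} & \text{frequency}\\ p^m+p^r-2 & p-1\\ Q-p^r & (p-1)p^{m-1}\\ Q-2 & (p-1)(p^{m-1}-1)(p^r-1)\\ Q-1 & (p-1)(p-2)p^{n-1}\\ Q & p^n-1+(p-1)p^{m-1}(p^r-1)\\ Q+p^m-2 & (p-1)(p^r-1)\\ Q+p^r-2 & (p-1)(p^{m-1}-1) \end{array} \]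
   Context: $[n]=\{1,\dots,n\}$; $u\cdot x=\sum_i u_ix_i$. An $[N,k,d]$ code is a linear code of length $N$, dimension $k$, minimum Hamming distance $d$. A nonzero codeword $c$ of a linear code $\mathcal{C}$ over $\mathbb{F}_p$ is minimal if $c'\in\mathcal{C}$ and $\mathrm{supp}(c')\subseteq\mathrm{supp}(c)$ imply $c'\in\mathbb{F}_pc$; $\mathcal{C}$ is minimal if all its nonzero codewords are. The Ashikhmin--Barg condition is $w_{\min}/w_{\max}>(p-1)/p$, where $w_{\min},w_{\max}$ are the smallest and largest nonzero weights; a code violates it if the inequality fails. Generalized order ideals: $[n]_{p-1}$ is the multiset in which each $i\in[n]$ has multiplicity $p-1$. A sub-multiset $J$ is identified with its multiplicity vector $(J_1,\dots,J_n)\in\{0,\dots,p-1\}^n=\mathbb{F}_p^n$; $J\subseteq J'$ means $J_i\le J'_i$ (as integers) for all $i$; $\bar J=\{i:J_i\ne0\}$. The hierarchical poset $\mathbb{H}(m,n)$ on $[n]$ has as its only strict relations $i\prec j$ for all $i\in[m]$, $j\in[n]\setminus[m]$; $\mathbb{GH}(m,n)$ denotes $[n]_{p-1}$ together with this order. $J$ is a saturated generalized order ideal if $\bar J$ is an order ideal (down-closed subset) of $\mathbb{H}(m,n)$ and $J_i=p-1$ whenever $j\in\bar J$ and $i\prec j$. For a saturated generalized order ideal $I$, $I(\mathbb{GP})\subseteq\mathbb{F}_p^n$ is the set of all saturated generalized order ideals contained in $I$. Thus for the $I$ considered here, $I(\mathbb{GP})=(\mathbb{F}_p^m\times0)\cup(\{-1\}^m\times(\mathbb{F}_p^{r}\setminus0))$.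 *)

theory Defs
  imports
    "Berlekamp_Zassenhaus.Finite_Field"
    "Jordan_Normal_Form.Matrix"
    "HOL-Library.Function_Algebras"
    "HOL-Library.Indicator_Function"
    "HOL-Library.Multiset"
begin

section \<open>Linear codes\<close>

text \<open>
  A word with finite coordinate set \<open>X\<close> is a function that vanishes outside \<open>X\<close>, so that
  addition, zero, support, weight and distance do not have to mention \<open>X\<close>.
\<close>

definition words :: "'i set \<Rightarrow> ('i \<Rightarrow> 'a::zero) set" where
  "words X = {c. \<forall>i. i \<notin> X \<longrightarrow> c i = 0}"

definition scale_word :: "'a::times \<Rightarrow> ('i \<Rightarrow> 'a) \<Rightarrow> 'i \<Rightarrow> 'a" where
  "scale_word a c = (\<lambda>i. a * c i)"

global_interpretation word: vector_space "scale_word :: 'a::field \<Rightarrow> ('i \<Rightarrow> 'a) \<Rightarrow> 'i \<Rightarrow> 'a"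
  by unfold_locales (auto simp: scale_word_def fun_eq_iff algebra_simps)

definition supp :: "('i \<Rightarrow> 'a::zero) \<Rightarrow> 'i set" where
  "supp c = {i. c i \<noteq> 0}"

definition weight :: "('i \<Rightarrow> 'a::zero) \<Rightarrow> nat" where
  "weight c = card (supp c)"

definition hamming_dist :: "('i \<Rightarrow> 'a) \<Rightarrow> ('i \<Rightarrow> 'a) \<Rightarrow> nat" where
  "hamming_dist c c' = card {i. c i \<noteq> c' i}"

definition min_dist :: "('i \<Rightarrow> 'a) set \<Rightarrow> nat" where
  "min_dist C = Inf {hamming_dist c c' | c c'. c \<in> C \<and> c' \<in> C \<and> c \<noteq> c'}"

definition linear_code :: "'i set \<Rightarrow> ('i \<Rightarrow> 'a::field) set \<Rightarrow> bool" where
  "linear_code X C \<longleftrightarrow> finite X \<and> C \<subseteq> words X \<and> word.subspace C"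

definition code_params ::
    "'i set \<Rightarrow> ('i \<Rightarrow> 'a::field) set \<Rightarrow> nat \<Rightarrow> nat \<Rightarrow> nat \<Rightarrow> bool" where
  "code_params X C N k d \<longleftrightarrow>
     linear_code X C \<and> card X = N \<and> word.dim C = k \<and> min_dist C = d"

definition minimal_codeword :: "('i \<Rightarrow> 'a::field) set \<Rightarrow> ('i \<Rightarrow> 'a) \<Rightarrow> bool" where
  "minimal_codeword C c \<longleftrightarrow> c \<in> C \<and> c \<noteq> 0 \<and>
     (\<forall>c'\<in>C. supp c' \<subseteq> supp c \<longrightarrow> (\<exists>a. c' = scale_word a c))"

definition minimal_code :: "('i \<Rightarrow> 'a::field) set \<Rightarrow> bool" where
  "minimal_code C \<longleftrightarrow> (\<forall>c\<in>C. c \<noteq> 0 \<longrightarrow> minimal_codeword C c)"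

definition nonzero_weights :: "('i \<Rightarrow> 'a::zero) set \<Rightarrow> nat set" where
  "nonzero_weights C = weight ` (C - {0})"

definition ashikhmin_barg :: "('i \<Rightarrow> 'a::{finite,field}) set \<Rightarrow> bool" where
  "ashikhmin_barg C \<longleftrightarrow>
     real (Min (nonzero_weights C)) / real (Max (nonzero_weights C))
       > (real CARD('a) - 1) / real CARD('a)"

text \<open>
  A table lists pairs (weight, frequency) for the nonzero codewords; the frequencies of
  rows with equal weight are added, and weights that do not occur in the table have frequency 0.
\<close>

definition has_weight_distribution :: "('i \<Rightarrow> 'a::zero) set \<Rightarrow> (nat \<times> nat) list \<Rightarrow> bool" where
  "has_weight_distribution C table \<longleftrightarrow>
     (\<forall>w. card {c \<in> C. c \<noteq> 0 \<and> weight c = w} = (\<Sum>(w', a)\<leftarrow>table. if w' = w then a else 0))"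


section \<open>Generalized order ideals\<close>

text \<open>
  Indices start at 0, as for the type \<^typ>\<open>'a vec\<close>: the set \<open>[n]\<close> is \<^term>\<open>{0..<n}\<close>.
  A poset on a ground set is given by its strict order relation.
\<close>

definition hier :: "nat \<Rightarrow> nat \<Rightarrow> nat rel" where
  "hier m n = {0..<m} \<times> ({0..<n} - {0..<m})"

definition order_ideal :: "'i set \<Rightarrow> 'i rel \<Rightarrow> 'i set \<Rightarrow> bool" where
  "order_ideal A R S \<longleftrightarrow> S \<subseteq> A \<and> (\<forall>j\<in>S. \<forall>i\<in>A. (i, j) \<in> R \<longrightarrow> i \<in> S)"

definition ground_mset :: "nat \<Rightarrow> 'i set \<Rightarrow> 'i multiset" where
  "ground_mset p A = repeat_mset (p - 1) (mset_set A)"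

definition saturated_ideal :: "nat \<Rightarrow> 'i set \<Rightarrow> 'i rel \<Rightarrow> 'i multiset \<Rightarrow> bool" where
  "saturated_ideal p A R J \<longleftrightarrow>
     J \<subseteq># ground_mset p A \<and> order_ideal A R (set_mset J) \<and>
     (\<forall>i j. j \<in># J \<and> (i, j) \<in> R \<longrightarrow> count J i = p - 1)"

definition mult_vec :: "nat \<Rightarrow> nat multiset \<Rightarrow> 'p::prime_card mod_ring vec" where
  "mult_vec n J = vec n (\<lambda>i. of_nat (count J i))"

definition saturated_subideals ::
    "nat \<Rightarrow> nat rel \<Rightarrow> nat multiset \<Rightarrow> 'p::prime_card mod_ring vec set" where
  "saturated_subideals n R I =
     mult_vec n ` {J. saturated_ideal CARD('p) {0..<n} R J \<and> J \<subseteq># I}"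


section \<open>The code of a function\<close>

definition coords :: "nat \<Rightarrow> 'a::zero vec set" where
  "coords n = carrier_vec n - {0\<^sub>v n}"

definition codeword :: "nat \<Rightarrow> ('a::field vec \<Rightarrow> 'a) \<Rightarrow> 'a \<Rightarrow> 'a vec \<Rightarrow> 'a vec \<Rightarrow> 'a" where
  "codeword n f s u = (\<lambda>x. if x \<in> coords n then s * f x + u \<bullet> x else 0)"

definition code_of :: "nat \<Rightarrow> ('a::field vec \<Rightarrow> 'a) \<Rightarrow> ('a vec \<Rightarrow> 'a) set" where
  "code_of n f = {codeword n f s u | s u. u \<in> carrier_vec n}"

end

theory Submission
  imports Defs "Berlekamp_Zassenhaus.Berlekamp_Type_Based"
begin

text \<open>
  Let \<open>D\<close> be the support of \<open>f\<close>. Writing vectors as \<open>(y, z)\<close> with \<open>y\<close> of length \<open>m\<close> and \<open>z\<close> of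
  length \<open>r\<close>, the set \<open>D\<close> is the disjoint union of the points \<open>(y, 0)\<close> with \<open>y \<noteq> 0\<close> and the points
  \<open>(-1, z)\<close> with \<open>z \<noteq> 0\<close> (lemma \<open>saturated_subideals_full\<close>). From there on only the cardinality
  \<open>q \<ge> 3\<close> of the field matters.

  For \<open>s \<noteq> 0\<close> the word \<open>c(s, u)\<close> differs from \<open>c(0, u)\<close> only on \<open>D\<close>, and its support is obtained from
  that of \<open>c(0, u)\<close> by removing the points of \<open>D\<close> with \<open>u \<bullet> x = -s\<close> and adding those with
  \<open>u \<bullet> x = 0\<close> (lemma \<open>weight_codeword\<close>). In the coordinate \<open>y\<close> or \<open>z\<close> of either part of \<open>D\<close>, these
  points form an affine hyperplane, with the origin removed if it lies there, or they are all points
  or none. For \<open>u = (a, b)\<close> the weight therefore depends only on whether \<open>a = 0\<close>, whether \<open>b = 0\<close>,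
  and whether the coordinate sum \<open>\<sigma> a\<close> is \<open>0\<close>, \<open>s\<close> or neither: on \<open>(-1, z)\<close> the functional takes
  the value \<open>b \<bullet> z - \<sigma> a\<close>. This gives lemma \<open>weight_table\<close>, and counting the
  parameters in each case gives the weight distribution. Since every weight with \<open>(s, u) \<noteq> (0, 0)\<close> is
  at least \<open>q\<^sup>m + q\<^sup>r - 2 > 0\<close>, the parametrisation is injective, so the code has \<open>q\<^sup>n\<^sup>+\<^sup>1\<close> words and
  dimension \<open>n + 1\<close>. The Ashikhmin--Barg inequality fails because the minimum weight is that of \<open>f\<close>
  itself, while \<open>Q\<close> is also a weight and already \<open>q (q\<^sup>m + q\<^sup>r - 2) \<le> Q\<close>.

  Minimality is a statement about zero sets. If \<open>s \<noteq> 0\<close>, subtracting the multiple of \<open>c(s, u)\<close> that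
  cancels \<open>f\<close> reduces it to the claim that no nonzero functional \<open>w\<close> vanishes on all zeros of
  \<open>c(s, u)\<close> (lemma \<open>zeros_span\<close>). All points with \<open>u \<bullet> x = 0\<close> outside \<open>D\<close> are zeros, and if \<open>w\<close> is
  not a multiple of \<open>u\<close> then \<open>w\<close> is nonzero at no fewer than \<open>(q - 1) q\<^sup>n\<^sup>-\<^sup>2\<close> points with \<open>u \<bullet> x = 0\<close>,
  more than \<open>D\<close> has. If \<open>w\<close> is a nonzero multiple of \<open>u\<close>, a point of \<open>D\<close> with \<open>u \<bullet> x = -s\<close> is a
  zero of \<open>c(s, u)\<close> at which \<open>w\<close> does not vanish. If \<open>s = 0\<close> and the zeros of \<open>u\<close> are zeros of
  \<open>c(s', u')\<close>, then \<open>s' f + u'\<close> vanishes on the hyperplane of \<open>u\<close>, which contains a line through the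
  origin whose other points lie in the first part of \<open>D\<close>; as \<open>f\<close> is constant on these
  \<open>q - 1 \<ge> 2\<close> points, \<open>s' = 0\<close>, and then \<open>u'\<close> is a multiple of \<open>u\<close>.
\<close>

section \<open>Counting vectors over a finite field\<close>

text \<open>
  Translating along \<open>x0\<close> permutes the level sets of \<open>w\<close> in \<open>S\<close>, so all of them have the same size.
\<close>

lemma card_level_set_translation:
  fixes S :: "'a::{finite,field} vec set"
  assumes S: "S \<subseteq> carrier_vec n" and w: "w \<in> carrier_vec n" and x0: "x0 \<in> carrier_vec n" "w \<bullet> x0 = 1"
    and closed: "\<And>x c. x \<in> S \<Longrightarrow> x + c \<cdot>\<^sub>v x0 \<in> S"
  shows "CARD('a) * card {x \<in> S. w \<bullet> x = t} = card S"
proof -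
  have fin: "finite S" using S finite_carrier_vec finite_subset by blast
  have le: "card {x \<in> S. w \<bullet> x = t} \<le> card {x \<in> S. w \<bullet> x = t'}" for t t'
  proof (rule card_inj_on_le[where f = "\<lambda>x. x + (t' - t) \<cdot>\<^sub>v x0"])
    show "inj_on (\<lambda>x. x + (t' - t) \<cdot>\<^sub>v x0) {x \<in> S. w \<bullet> x = t}"
    proof (rule inj_onI)
      fix x y assume xy: "x \<in> {x \<in> S. w \<bullet> x = t}" "y \<in> {x \<in> S. w \<bullet> x = t}"
        and eq: "x + (t' - t) \<cdot>\<^sub>v x0 = y + (t' - t) \<cdot>\<^sub>v x0"
      have c: "x \<in> carrier_vec n" "y \<in> carrier_vec n" using xy S by auto
      show "x = y"
      proof (rule eq_vecI)
        fix i assume "i < dim_vec y"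
        then show "x $ i = y $ i"
          using arg_cong[OF eq, of "\<lambda>v. v $ i"] c x0 by auto
      qed (use c in auto)
    qed
    show "(\<lambda>x. x + (t' - t) \<cdot>\<^sub>v x0) ` {x \<in> S. w \<bullet> x = t} \<subseteq> {x \<in> S. w \<bullet> x = t'}"
    proof clarify
      fix x assume x: "x \<in> S" 
      have "w \<bullet> (x + (t' - w \<bullet> x) \<cdot>\<^sub>v x0) = t'"
        using x S w x0 by (subst scalar_prod_add_distrib[of _ n]) auto
      then show "x + (t' - w \<bullet> x) \<cdot>\<^sub>v x0 \<in> S \<and> w \<bullet> (x + (t' - w \<bullet> x) \<cdot>\<^sub>v x0) = t'"
        using closed x by blast
    qed
  qed (use fin in auto)
  have "card S = card (\<Union>c\<in>UNIV. {x \<in> S. w \<bullet> x = c})" by (rule arg_cong[of _ _ card]) auto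
  also have "\<dots> = (\<Sum>c\<in>UNIV. card {x \<in> S. w \<bullet> x = c})"
    using fin by (intro card_UN_disjoint) auto
  also have "\<dots> = (\<Sum>c\<in>(UNIV :: 'a set). card {x \<in> S. w \<bullet> x = t})"
    using le by (intro sum.cong refl antisym)
  finally show ?thesis by simp
qed

lemma ex_scalar_prod_eq_1:
  fixes u :: "'a::field vec"
  assumes "u \<in> carrier_vec n" "u \<noteq> 0\<^sub>v n"
  obtains x where "x \<in> carrier_vec n" "u \<bullet> x = 1"
proof -
  obtain i where i: "i < n" "u $ i \<noteq> 0" using assms by (metis carrier_vecD eq_vecI index_zero_vec)
  have "u \<bullet> (inverse (u $ i) \<cdot>\<^sub>v unit_vec n i) = 1" using i assms by simp
  then show ?thesis by (intro that) auto
qed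

text \<open>
  Two functionals, the second not a multiple of the first, can be separated by a point.
\<close>

lemma ex_scalar_prod_eq_0_1:
  fixes u w :: "'a::field vec"
  assumes u: "u \<in> carrier_vec n" "u \<noteq> 0\<^sub>v n" and w: "w \<in> carrier_vec n" "\<And>c. w \<noteq> c \<cdot>\<^sub>v u"
  obtains x where "x \<in> carrier_vec n" "u \<bullet> x = 0" "w \<bullet> x = 1"
proof -
  obtain i where i: "i < n" "u $ i \<noteq> 0" using u by (metis carrier_vecD eq_vecI index_zero_vec)
  \<comment> \<open>Subtracting this multiple of \<open>u\<close> makes coordinate \<open>i\<close> vanish, so \<open>v\<close> ignores changes of that coordinate.\<close>
  define v where "v = w - (w $ i / u $ i) \<cdot>\<^sub>v u"
  have v: "v \<in> carrier_vec n" using u w by (auto simp: v_def)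
  have "v \<noteq> 0\<^sub>v n"
  proof
    assume "v = 0\<^sub>v n"
    have "w = (w $ i / u $ i) \<cdot>\<^sub>v u"
    proof (rule eq_vecI)
      fix j assume "j < dim_vec ((w $ i / u $ i) \<cdot>\<^sub>v u)"
      then show "w $ j = ((w $ i / u $ i) \<cdot>\<^sub>v u) $ j"
        using arg_cong[OF \<open>v = 0\<^sub>v n\<close>, of "\<lambda>v. v $ j"] u w by (auto simp: v_def)
    qed (use u w in auto)
    then show False using w(2) by blast
  qed
  then obtain y where y: "y \<in> carrier_vec n" "v \<bullet> y = 1" using ex_scalar_prod_eq_1 v by metis
  \<comment> \<open>Correcting \<open>y\<close> in coordinate \<open>i\<close> puts it into the hyperplane of \<open>u\<close>.\<close>
  define x where "x = y - (u \<bullet> y / u $ i) \<cdot>\<^sub>v unit_vec n i"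
  have x: "x \<in> carrier_vec n" using y by (auto simp: x_def)
  have ux: "u \<bullet> x = 0"
    unfolding x_def using u y i by (subst scalar_prod_minus_distrib[of _ n]) auto
  have "w \<bullet> x = w \<bullet> y - (u \<bullet> y / u $ i) * w $ i"
    unfolding x_def using w y i by (subst scalar_prod_minus_distrib[of _ n]) auto
  also have "\<dots> = v \<bullet> y"
    unfolding v_def using w y u i by (subst minus_scalar_prod_distrib[of _ n]) auto
  finally show ?thesis using that x ux y by simp
qed

lemma card_hyperplane:
  fixes u :: "'a::{finite,field} vec"
  assumes u: "u \<in> carrier_vec n" "u \<noteq> 0\<^sub>v n"
  shows "card {x \<in> carrier_vec n. u \<bullet> x = t} = CARD('a) ^ (n - 1)"
proof -
  obtain x0 where x0: "x0 \<in> carrier_vec n" "u \<bullet> x0 = 1" using ex_scalar_prod_eq_1 u by metis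
  have "n > 0" using u by (cases n) auto
  then have "CARD('a) ^ n = CARD('a) * CARD('a) ^ (n - 1)" by (cases n) auto
  moreover have "CARD('a) * card {x \<in> carrier_vec n. u \<bullet> x = t} = CARD('a) ^ n"
    unfolding card_carrier_vec[symmetric]
    by (rule card_level_set_translation[OF _ u(1) x0]) (use x0 in auto)
  ultimately show ?thesis by simp
qed

lemma card_off_hyperplane:
  fixes u :: "'a::{finite,field} vec"
  assumes u: "u \<in> carrier_vec n" "u \<noteq> 0\<^sub>v n"
  shows "card {x \<in> carrier_vec n. u \<bullet> x \<noteq> 0} = (CARD('a) - 1) * CARD('a) ^ (n - 1)"
proof -
  have "n > 0" using u by (cases n) auto
  then have "CARD('a) ^ n = CARD('a) * CARD('a) ^ (n - 1)" by (cases n) auto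
  moreover have "{x \<in> carrier_vec n. u \<bullet> x \<noteq> 0} = carrier_vec n - {x \<in> carrier_vec n. u \<bullet> x = 0}"
    by auto
  then have "card {x \<in> carrier_vec n. u \<bullet> x \<noteq> 0} = CARD('a) ^ n - CARD('a) ^ (n - 1)"
    by (simp only:) (subst card_Diff_subset; simp add: card_carrier_vec card_hyperplane[OF u])
  ultimately show ?thesis by (simp add: diff_mult_distrib)
qed

lemma card_hyperplane_Diff_hyperplane:
  fixes u w :: "'a::{finite,field} vec"
  assumes u: "u \<in> carrier_vec n" "u \<noteq> 0\<^sub>v n" and w: "w \<in> carrier_vec n" "\<And>c. w \<noteq> c \<cdot>\<^sub>v u"
    and n: "n \<ge> 2"
  shows "card {x \<in> carrier_vec n. u \<bullet> x = 0 \<and> w \<bullet> x \<noteq> 0} = (CARD('a) - 1) * CARD('a) ^ (n - 2)"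
proof -
  let ?H = "{x \<in> carrier_vec n. u \<bullet> x = 0}" and ?q = "CARD('a)"
  obtain x0 where x0: "x0 \<in> carrier_vec n" "u \<bullet> x0 = 0" "w \<bullet> x0 = 1"
    using ex_scalar_prod_eq_0_1 u w by metis
  have q: "?q ^ (n - 1) = ?q * ?q ^ (n - 2)" using le_Suc_ex[OF n] by auto
  have "?q * card {x \<in> ?H. w \<bullet> x = 0} = card ?H"
  proof (rule card_level_set_translation[OF _ w(1) x0(1) x0(3)])
    fix x c assume "x \<in> ?H"
    then show "x + c \<cdot>\<^sub>v x0 \<in> ?H"
      using u x0 by (auto simp: scalar_prod_add_distrib[of _ n])
  qed auto
  then have c0: "card {x \<in> ?H. w \<bullet> x = 0} = ?q ^ (n - 2)"
    unfolding card_hyperplane[OF u] q by simp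
  have fin: "finite ?H" by (rule finite_subset[OF _ finite_carrier_vec]) auto
  have "{x \<in> carrier_vec n. u \<bullet> x = 0 \<and> w \<bullet> x \<noteq> 0} = ?H - {x \<in> ?H. w \<bullet> x = 0}" by auto
  then have "card {x \<in> carrier_vec n. u \<bullet> x = 0 \<and> w \<bullet> x \<noteq> 0} = ?q ^ (n - 1) - ?q ^ (n - 2)"
    by (simp only:) (subst card_Diff_subset; use fin c0 card_hyperplane[OF u] in auto)
  then show ?thesis by (simp only: q diff_mult_distrib mult_1)
qed

lemma card_nonzero_level_set:
  fixes u :: "'a::{finite,field} vec"
  assumes "u \<in> carrier_vec k"
  shows "card {x \<in> carrier_vec k - {0\<^sub>v k}. u \<bullet> x = t} =
    (if u = 0\<^sub>v k then if t = 0 then CARD('a) ^ k - 1 else 0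
     else CARD('a) ^ (k - 1) - (if t = 0 then 1 else 0))"
proof -
  have "{x \<in> carrier_vec k - {0\<^sub>v k}. u \<bullet> x = t} =
      {x \<in> carrier_vec k. u \<bullet> x = t} - (if t = 0 then {0\<^sub>v k} else {})"
    using assms by auto
  then have "card {x \<in> carrier_vec k - {0\<^sub>v k}. u \<bullet> x = t} =
      card {x \<in> carrier_vec k. u \<bullet> x = t} - (if t = 0 then 1 else 0)"
    using assms by (simp only:) (subst card_Diff_subset; auto)
  moreover have "card {x \<in> carrier_vec k. u \<bullet> x = t} = (if t = 0 then CARD('a) ^ k else 0)" if "u = 0\<^sub>v k"
  proof (cases "t = 0")
    case True
    then have "{x \<in> carrier_vec k. u \<bullet> x = t} = carrier_vec k" using that by auto
    then show ?thesis using True by (simp add: card_carrier_vec)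
  next
    case False
    then have "{x \<in> carrier_vec k. u \<bullet> x = t} = {}" using that by auto
    then show ?thesis using False by simp
  qed
  ultimately show ?thesis using assms card_hyperplane[OF assms] by auto
qed

section \<open>Dimension, minimum distance and weights of a linear code\<close>

lemma card_span_independent:
  fixes B :: "('i \<Rightarrow> 'a::{finite,field}) set"
  assumes "finite B" "word.independent B"
  shows "finite (word.span B) \<and> card (word.span B) = CARD('a) ^ card B"
  using assms
proof (induction B rule: finite_induct)
  case empty
  then show ?case by simp
next
  case (insert b B)
  have ind: "word.independent B" and b: "b \<notin> word.span B"
    using insert by (auto simp: word.independent_insert)
  have IH: "finite (word.span B)" "card (word.span B) = CARD('a) ^ card B"
    using insert.IH[OF ind] by auto
  let ?\<phi> = "\<lambda>(k, v). scale_word k b + v"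
  \<comment> \<open>Each vector of the larger span is uniquely a multiple of \<open>b\<close> plus a vector of the smaller one.\<close>
  have img: "word.span (insert b B) = ?\<phi> ` (UNIV \<times> word.span B)"
  proof (intro equalityI subsetI)
    fix x assume "x \<in> word.span (insert b B)"
    then obtain k where "x - scale_word k b \<in> word.span B" by (auto simp: word.span_insert)
    then show "x \<in> ?\<phi> ` (UNIV \<times> word.span B)"
      by (intro image_eqI[where x = "(k, x - scale_word k b)"]) auto
  next
    fix x assume "x \<in> ?\<phi> ` (UNIV \<times> word.span B)"
    then obtain k v where "x = scale_word k b + v" "v \<in> word.span B" by auto
    then have "x - scale_word k b \<in> word.span B" by simp
    then show "x \<in> word.span (insert b B)" unfolding word.span_insert by blast
  qed
  have inj: "inj_on ?\<phi> (UNIV \<times> word.span B)"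
  proof (rule inj_onI, clarify)
    fix k v k' v'
    assume v: "v \<in> word.span B" "v' \<in> word.span B"
      and eq: "scale_word k b + v = scale_word k' b + v'"
    have "scale_word (k - k') b = v' - v"
      using eq by (simp add: word.scale_left_diff_distrib algebra_simps)
    then have mem: "scale_word (k - k') b \<in> word.span B" using v by (simp add: word.span_diff)
    have "k = k'"
    proof (rule ccontr)
      assume "k \<noteq> k'"
      then have "b = scale_word (inverse (k - k')) (scale_word (k - k') b)" by simp
      also have "\<dots> \<in> word.span B" using mem by (rule word.span_scale)
      finally show False using b by simp
    qed
    then show "k = k' \<and> v = v'" using eq by simp
  qed
  have "card (word.span (insert b B)) = CARD('a) * card (word.span B)"
    unfolding img card_image[OF inj] by (simp add: card_cartesian_product)
  then show ?case using IH insert.hyps img by auto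
qed

lemma card_subspace:
  fixes C :: "('i \<Rightarrow> 'a::{finite,field}) set"
  assumes C: "word.subspace C" "finite C"
  shows "card C = CARD('a) ^ word.dim C"
proof -
  obtain B where B: "B \<subseteq> C" "word.independent B" "C \<subseteq> word.span B" "card B = word.dim C"
    using word.basis_exists by blast
  have "word.span B = C" using B C by (metis equalityI word.span_minimal)
  then show ?thesis using card_span_independent[of B] B C finite_subset by metis
qed

lemma min_dist_eqI:
  fixes C :: "('i \<Rightarrow> 'a::field) set"
  assumes C: "word.subspace C" and ex: "c \<in> C" "c \<noteq> 0" "weight c = d"
    and le: "\<And>c. c \<in> C \<Longrightarrow> c \<noteq> 0 \<Longrightarrow> d \<le> weight c"
  shows "min_dist C = d"
  unfolding min_dist_def
proof (rule cInf_eq_minimum)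
  have hd: "hamming_dist a b = weight (a - b)" for a b :: "'i \<Rightarrow> 'a"
    by (simp add: hamming_dist_def weight_def supp_def)
  have "0 \<in> C" using C by (rule word.subspace_0)
  moreover have "hamming_dist c 0 = d" using ex by (simp add: hd)
  ultimately show "d \<in> {hamming_dist c c' |c c'. c \<in> C \<and> c' \<in> C \<and> c \<noteq> c'}" using ex by blast
  fix x assume "x \<in> {hamming_dist c c' |c c'. c \<in> C \<and> c' \<in> C \<and> c \<noteq> c'}"
  then obtain a b where "x = weight (a - b)" "a \<in> C" "b \<in> C" "a \<noteq> b" by (auto simp: hd)
  then show "d \<le> x" using le[of "a - b"] word.subspace_diff[OF C] by simp
qed

text \<open>
  If a set is partitioned into classes \<open>K\<close> on each of which \<open>g\<close> has a constant value \<open>w\<close>, the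
  cardinalities of the classes, added over equal values, are the frequencies of \<open>g\<close>.
\<close>

lemma card_weight_classes:
  assumes "sorted_wrt (\<lambda>x y. snd x \<inter> snd y = {}) L"
    and "\<forall>(w, K) \<in> set L. finite K \<and> (\<forall>x\<in>K. g x = w)"
  shows "card {x \<in> (\<Union>(w, K) \<in> set L. K). g x = v} = (\<Sum>(w, K)\<leftarrow>L. if w = v then card K else 0)"
  using assms
proof (induction L)
  case Nil
  then show ?case by simp
next
  case (Cons z L)
  obtain w K where z: "z = (w, K)" by (cases z)
  let ?U = "\<Union>(w, K) \<in> set L. K"
  have dj: "K \<inter> ?U = {}" and K: "finite K" "\<And>x. x \<in> K \<Longrightarrow> g x = w" and U: "finite ?U"
    using Cons.prems by (fastforce simp: z)+
  have "{x \<in> (\<Union>(w, K) \<in> set (z # L). K). g x = v} = (if w = v then K else {}) \<union> {x \<in> ?U. g x = v}"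
    using K by (auto simp: z)
  also have "card \<dots> = card (if w = v then K else {}) + card {x \<in> ?U. g x = v}"
    using K U dj by (intro card_Un_disjoint) auto
  finally show ?case using Cons by (simp add: z)
qed

lemma has_weight_distribution_nonzero_weights:
  assumes "has_weight_distribution C T" "finite C"
  shows "nonzero_weights C \<subseteq> set (map fst T)"
proof
  fix w assume "w \<in> nonzero_weights C"
  then have "{c \<in> C. c \<noteq> 0 \<and> weight c = w} \<noteq> {}" by (auto simp: nonzero_weights_def)
  then have "card {c \<in> C. c \<noteq> 0 \<and> weight c = w} \<noteq> 0" using assms(2) by simp
  then have "(\<Sum>(w', a)\<leftarrow>T. if w' = w then a else 0) \<noteq> 0"
    using assms(1) unfolding has_weight_distribution_def by metis
  moreover have "(\<Sum>(w', a)\<leftarrow>T. if w' = w then a else 0) = 0" if "w \<notin> set (map fst T)"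
    using that by (induction T) auto
  ultimately show "w \<in> set (map fst T)" by (rule contrapos_np)
qed

section \<open>The saturated subideals of the full ideal\<close>

text \<open>
  The nonzero elements of \<open>(K\<^sup>m \<times> 0) \<union> ({-1}\<^sup>m \<times> (K\<^sup>r - 0))\<close> for the field \<open>K\<close>. Vectors of length \<open>m + r\<close> are written
  with the append operation on vectors.
\<close>

definition ideal_points :: "nat \<Rightarrow> nat \<Rightarrow> 'a::field vec set" where
  "ideal_points m r =
     (\<lambda>a. a @\<^sub>v 0\<^sub>v r) ` (carrier_vec m - {0\<^sub>v m}) \<union>
     (\<lambda>b. vec m (\<lambda>_. - 1) @\<^sub>v b) ` (carrier_vec r - {0\<^sub>v r})"

lemma append_zero_vec: "0\<^sub>v m @\<^sub>v 0\<^sub>v r = 0\<^sub>v (m + r)"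
  by (rule eq_vecI) auto

lemma append_vec_inject:
  "a \<in> carrier_vec m \<Longrightarrow> a' \<in> carrier_vec m \<Longrightarrow> a @\<^sub>v b = a' @\<^sub>v b' \<longleftrightarrow> a = a' \<and> b = b'"
  by (rule append_vec_eq)

lemma append_eq_zero_iff:
  "a \<in> carrier_vec m \<Longrightarrow> a @\<^sub>v b = 0\<^sub>v (m + r) \<longleftrightarrow> a = 0\<^sub>v m \<and> b = 0\<^sub>v r"
  by (simp add: append_zero_vec[symmetric] append_vec_inject[of _ m])

lemma carrier_vec_appendE:
  assumes "u \<in> carrier_vec (m + r)"
  obtains a b where "a \<in> carrier_vec m" "b \<in> carrier_vec r" "u = a @\<^sub>v b"
  using that[OF vec_first_carrier vec_last_carrier vec_first_last_append[OF assms, symmetric]] .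

lemma count_ground_mset: "finite A \<Longrightarrow> count (ground_mset p A) i = (if i \<in> A then p - 1 else 0)"
  by (simp add: ground_mset_def count_mset_set')

text \<open>
  Full multiplicity \<open>p - 1\<close> corresponds to the coordinate \<open>-1\<close>.
\<close>

lemma of_nat_card_minus_1: "of_nat (CARD('p::prime_card) - 1) = (- 1 :: 'p mod_ring)"
proof -
  have "1 \<le> CARD('p)" using nontriv[where 'a = 'p] by simp
  then show ?thesis by (simp add: of_nat_diff)
qed

lemma of_nat_mod_ring_surj:
  obtains k where "k \<le> CARD('p::prime_card) - 1" "of_nat k = (x :: 'p mod_ring)"
proof -
  obtain i where "i < CARD('p)" "x = of_nat i" using surj_of_nat_mod_ring by blast
  then show ?thesis by (intro that[of i]) auto
qed

text \<open>
  Each vector comes from a submultiset of the ground multiset. The two properties of the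
  multiplicities are what membership in the ideal and saturation refer to.
\<close>

lemma mult_vec_surj:
  fixes x :: "'p::prime_card mod_ring vec"
  assumes "x \<in> carrier_vec n"
  obtains J where "J \<subseteq># ground_mset CARD('p) {0..<n}" "mult_vec n J = x"
    "\<And>i. i < n \<Longrightarrow> count J i = 0 \<longleftrightarrow> x $ i = 0"
    "\<And>i. i < n \<Longrightarrow> x $ i = - 1 \<Longrightarrow> count J i = CARD('p) - 1"
proof -
  have "\<forall>y :: 'p mod_ring. \<exists>k. k \<le> CARD('p) - 1 \<and> of_nat k = y \<and> (y = 0 \<longrightarrow> k = 0) \<and> (y = -1 \<longrightarrow> k = CARD('p) - 1)" (is "\<forall>y. ?P y")
  proof
    fix y :: "'p mod_ring"
    consider "y = 0" | "y = - 1" | "y \<noteq> 0" "y \<noteq> -1" by blast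
    then show "?P y"
    proof cases
      case 1
      then show ?thesis by (intro exI[of _ 0]) auto
    next
      case 2
      then show ?thesis using of_nat_card_minus_1[where 'p = 'p] by (intro exI[of _ "CARD('p) - 1"]) auto
    next
      case 3
      then show ?thesis using of_nat_mod_ring_surj[of y] by metis
    qed
  qed
  then have "\<exists>k :: 'p mod_ring \<Rightarrow> nat. \<forall>y. k y \<le> CARD('p) - 1 \<and> of_nat (k y) = y \<and>
      (y = 0 \<longrightarrow> k y = 0) \<and> (y = - 1 \<longrightarrow> k y = CARD('p) - 1)"
    by (rule choice)
  then obtain k :: "'p mod_ring \<Rightarrow> nat" where k: "\<And>y. k y \<le> CARD('p) - 1" "\<And>y. of_nat (k y) = y"
    "k 0 = 0" "k (- 1) = CARD('p) - 1" by auto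
  have k0: "k y = 0 \<longleftrightarrow> y = 0" for y using k(2)[of y] k(3) by auto
  define J where "J = (\<Sum>i<n. replicate_mset (k (x $ i)) i)"
  have J: "count J i = (if i < n then k (x $ i) else 0)" for i
    by (simp add: J_def count_sum)
  show ?thesis
  proof (rule that[of J])
    show "J \<subseteq># ground_mset CARD('p) {0..<n}"
      by (rule mset_subset_eqI) (use k(1) in \<open>simp add: J count_ground_mset\<close>)
    show "mult_vec n J = x" using assms by (auto simp: mult_vec_def J k)
  qed (simp_all add: J k0 k)
qed

text \<open>
  In the hierarchical order every element of the upper level lies above the whole lower level.
  Hence a saturated ideal either avoids the upper level, or has full multiplicity on the lower one.
\<close>

lemma saturated_subideals_full:
  fixes I :: "nat multiset"
  assumes I: "saturated_ideal CARD('p) {0..<m + r} (hier m (m + r)) I"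
    and full: "\<forall>i\<in>{0..<m + r}. count I i = CARD('p) - 1" and m: "m > 0"
  shows "saturated_subideals (m + r) (hier m (m + r)) I - {0\<^sub>v (m + r)} =
    (ideal_points m r :: 'p::prime_card mod_ring vec set)"
proof (intro equalityI subsetI)
  fix x :: "'p mod_ring vec"
  assume "x \<in> saturated_subideals (m + r) (hier m (m + r)) I - {0\<^sub>v (m + r)}"
  then obtain J where x: "x = mult_vec (m + r) J" "x \<noteq> 0\<^sub>v (m + r)"
    and J: "saturated_ideal CARD('p) {0..<m + r} (hier m (m + r)) J"
    by (auto simp: saturated_subideals_def)
  have "x \<in> carrier_vec (m + r)" by (simp add: x mult_vec_def)
  then obtain a b where ab: "a \<in> carrier_vec m" "b \<in> carrier_vec r" "x = a @\<^sub>v b"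
    by (rule carrier_vec_appendE)
  show "x \<in> ideal_points m r"
  proof (cases "b = 0\<^sub>v r")
    case True
    then have "a \<noteq> 0\<^sub>v m" using x ab by (auto simp: append_zero_vec)
    then show ?thesis using ab True by (auto simp: ideal_points_def)
  next
    case False
    then obtain j where j: "j < r" "b $ j \<noteq> 0"
      using ab by (metis carrier_vecD eq_vecI index_zero_vec)
    have "x $ (m + j) = b $ j" using ab j by auto
    moreover have "x $ (m + j) = of_nat (count J (m + j))" using j by (simp add: x mult_vec_def)
    ultimately have "m + j \<in># J" using j by (metis of_nat_0 not_in_iff)
    \<comment> \<open>The ideal contains an element of the upper level, so it is full below.\<close>
    then have cnt: "count J i = CARD('p) - 1" if "i < m" for i
      using J that j by (fastforce simp: saturated_ideal_def hier_def)
    have "a = vec m (\<lambda>_. - 1)"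
    proof (rule eq_vecI)
      fix i assume "i < dim_vec (vec m (\<lambda>_. - 1 :: 'p mod_ring))"
      then have i: "i < m" by simp
      then have "a $ i = x $ i" using ab by simp
      also have "\<dots> = - 1" using i cnt[OF i] of_nat_card_minus_1[where 'p = 'p] by (simp add: x mult_vec_def)
      finally show "a $ i = vec m (\<lambda>_. - 1) $ i" using i by simp
    qed (use ab in simp)
    then show ?thesis using ab False by (auto simp: ideal_points_def)
  qed
next
  fix x :: "'p mod_ring vec"
  assume "x \<in> ideal_points m r"
  then consider (low) a where "a \<in> carrier_vec m" "a \<noteq> 0\<^sub>v m" "x = a @\<^sub>v 0\<^sub>v r"
    | (high) b where "b \<in> carrier_vec r" "b \<noteq> 0\<^sub>v r" "x = vec m (\<lambda>_. - 1) @\<^sub>v b"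
    by (auto simp: ideal_points_def)
  then have x: "x \<in> carrier_vec (m + r)" "x \<noteq> 0\<^sub>v (m + r)"
    and low_or_high: "(\<forall>i<r. x $ (m + i) = 0) \<or> (\<forall>i<m. x $ i = - 1)"
    by (cases; auto simp: append_eq_zero_iff[of _ m] append_eq_zero_iff[OF vec_carrier])+
  obtain J where J: "J \<subseteq># ground_mset CARD('p) {0..<m + r}" "mult_vec (m + r) J = x"
    "\<And>i. i < m + r \<Longrightarrow> count J i = 0 \<longleftrightarrow> x $ i = 0"
    "\<And>i. i < m + r \<Longrightarrow> x $ i = - 1 \<Longrightarrow> count J i = CARD('p) - 1"
    using mult_vec_surj[OF x(1)] by metis
  have cnt: "count J i = CARD('p) - 1" if "j \<in># J" "(i, j) \<in> hier m (m + r)" for i j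
  proof -
    have "i < m" "m \<le> j" "j < m + r" using that by (auto simp: hier_def)
    moreover then have "x $ (m + (j - m)) \<noteq> 0"
      using J(3)[of j] that(1) by (metis le_add_diff_inverse not_in_iff)
    ultimately show ?thesis using low_or_high J(4)[of i] 
      by (metis add.commute less_diff_conv2 trans_less_add1)
  qed
  have pos: "CARD('p) - 1 > 0" using nontriv[where 'a = 'p] by simp
  have sub: "set_mset J \<subseteq> {0..<m + r}"
    proof
    fix i assume "i \<in># J"
    then have "i \<in># ground_mset CARD('p) {0..<m + r}" using J(1) by (rule mset_subset_eqD[rotated])
    then show "i \<in> {0..<m + r}" by (metis count_ground_mset finite_atLeastLessThan not_in_iff)
  qed
  have "saturated_ideal CARD('p) {0..<m + r} (hier m (m + r)) J"
    unfolding saturated_ideal_def order_ideal_def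
  proof (intro conjI ballI impI allI)
    fix i j assume "j \<in># J" "(i, j) \<in> hier m (m + r)"
    then show "i \<in># J" using cnt pos by (metis count_inI not_less_zero)
  qed (use J(1) sub cnt in auto)
  moreover have "ground_mset CARD('p) {0..<m + r} \<subseteq># I"
    by (rule mset_subset_eqI) (simp add: count_ground_mset full)
  ultimately show "x \<in> saturated_subideals (m + r) (hier m (m + r)) I - {0\<^sub>v (m + r)}"
    using J x by (auto simp: saturated_subideals_def)
qed

section \<open>The code of the ideal points\<close>

subsection \<open>Weights of the codewords\<close>

text \<open>
  The code of the indicator function of \<^const>\<open>ideal_points\<close> over a field of cardinality \<open>q \<ge> 3\<close>.
  The cardinality is a parameter of its own so that it can be written \<open>q\<close>.
\<close>

locale ideal_code =
  fixes q m r :: nat and f :: "'a::{finite,field} vec \<Rightarrow> 'a"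
  assumes q: "q = CARD('a)" and m: "m \<ge> 2" and r: "r \<ge> 2" and card_ge_3: "q \<ge> 3"
    and f: "\<And>x. x \<in> carrier_vec (m + r) \<Longrightarrow> f x = indicator (ideal_points m r) x"
begin

text \<open>
  Here \<open>\<sigma> a\<close> is the sum of the coordinates of \<open>a\<close>, and \<open>cw s u\<close> the codeword \<open>c(s, u)\<close>.
\<close>

abbreviation D :: "'a vec set" where "D \<equiv> ideal_points m r"
abbreviation V :: "nat \<Rightarrow> 'a vec set" where "V k \<equiv> carrier_vec k"
abbreviation cw :: "'a \<Rightarrow> 'a vec \<Rightarrow> 'a vec \<Rightarrow> 'a" where "cw \<equiv> codeword (m + r) f"
abbreviation \<sigma> :: "'a vec \<Rightarrow> 'a" where "\<sigma> a \<equiv> vec m (\<lambda>_. 1) \<bullet> a"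
abbreviation C :: "('a vec \<Rightarrow> 'a) set" where "C \<equiv> code_of (m + r) f"

lemmas card_V = card_carrier_vec[where 'b = 'a, folded q]
lemmas card_hyperplane_q = card_hyperplane[where 'a = 'a, folded q]
lemmas card_off_hyperplane_q = card_off_hyperplane[where 'a = 'a, folded q]
lemmas card_hyperplane_Diff_q = card_hyperplane_Diff_hyperplane[where 'a = 'a, folded q]
lemmas card_nonzero_level_q = card_nonzero_level_set[where 'a = 'a, folded q]

lemma D_subset: "D \<subseteq> coords (m + r)"
  by (auto simp: ideal_points_def coords_def append_eq_zero_iff[of _ m] append_eq_zero_iff[OF vec_carrier])

lemma coords_subset: "coords (m + r) \<subseteq> V (m + r)"
  by (auto simp: coords_def)

lemma finite_D: "finite D"
  using D_subset coords_subset finite_carrier_vec finite_subset by metis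

lemma f_coords: "x \<in> coords (m + r) \<Longrightarrow> f x = (if x \<in> D then 1 else 0)"
  using f[of x] coords_subset by auto

lemma minus_ones_scalar_prod:
  assumes "a \<in> V m"
  shows "a \<bullet> vec m (\<lambda>_. - 1) = - \<sigma> a"
  using assms by (simp add: scalar_prod_def sum_negf)

lemma image_level: "{x. x \<in> g ` A \<and> P x} = g ` {y \<in> A. P (g y)}"
  by auto

text \<open>
  The shift by \<open>\<sigma> a\<close> arises because \<open>(a, b)\<close> takes the value \<open>b \<bullet> z - \<sigma> a\<close> at the point \<open>(-1, z)\<close>.
\<close>

lemma card_D_level:
  assumes a: "a \<in> V m" and b: "b \<in> V r"
  shows "card {x \<in> D. (a @\<^sub>v b) \<bullet> x = t} =
    card {y \<in> V m - {0\<^sub>v m}. a \<bullet> y = t} + card {z \<in> V r - {0\<^sub>v r}. b \<bullet> z = t + \<sigma> a}"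
proof -
  let ?A = "{y \<in> V m - {0\<^sub>v m}. a \<bullet> y = t}" and ?B = "{z \<in> V r - {0\<^sub>v r}. b \<bullet> z = t + \<sigma> a}"
  let ?g = "\<lambda>y. y @\<^sub>v 0\<^sub>v r" and ?h = "\<lambda>z. vec m (\<lambda>_. - 1) @\<^sub>v z"
  have g: "(a @\<^sub>v b) \<bullet> ?g y = a \<bullet> y" if "y \<in> V m" for y
    using a b that by (subst scalar_prod_append[of _ m _ r]) auto
  have h: "(a @\<^sub>v b) \<bullet> ?h z = t \<longleftrightarrow> b \<bullet> z = t + \<sigma> a" if "z \<in> V r" for z
    using a b that
    by (subst scalar_prod_append[of _ m _ r]) (auto simp: minus_ones_scalar_prod algebra_simps)
  have "{x \<in> D. (a @\<^sub>v b) \<bullet> x = t} =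
      {x \<in> ?g ` (V m - {0\<^sub>v m}). (a @\<^sub>v b) \<bullet> x = t} \<union>
      {x \<in> ?h ` (V r - {0\<^sub>v r}). (a @\<^sub>v b) \<bullet> x = t}"
    unfolding ideal_points_def by (rule Set.set_eqI) (simp only: Un_iff mem_Collect_eq conj_disj_distribR)
  moreover have "{x \<in> ?g ` (V m - {0\<^sub>v m}). (a @\<^sub>v b) \<bullet> x = t} = ?g ` ?A"
    using g unfolding image_level by (intro arg_cong[of _ _ "image ?g"] Collect_cong) (metis DiffE)
  moreover have "{x \<in> ?h ` (V r - {0\<^sub>v r}). (a @\<^sub>v b) \<bullet> x = t} = ?h ` ?B"
    using h unfolding image_level by (intro arg_cong[of _ _ "image ?h"] Collect_cong) (metis DiffE)
  moreover have "inj_on ?g ?A"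
    by (rule inj_onI) (metis (no_types, lifting) mem_Collect_eq Diff_iff append_vec_inject)
  moreover have "inj_on ?h ?B"
    by (rule inj_onI) (simp only: append_vec_inject[OF vec_carrier vec_carrier])
  moreover have "?g ` ?A \<inter> ?h ` ?B = {}"
  proof -
    have "y @\<^sub>v 0\<^sub>v r \<noteq> vec m (\<lambda>_. - 1) @\<^sub>v z" if "y \<in> V m" "z \<noteq> 0\<^sub>v r" for y z
      using that append_vec_inject[OF that(1) vec_carrier] by metis
    then show ?thesis by blast
  qed
  moreover have "finite ?A" "finite ?B" by auto
  ultimately show ?thesis by (simp only: card_Un_disjoint card_image finite_imageI)
qed

lemma weight_codeword_0:
  assumes "u \<in> V (m + r)" "u \<noteq> 0\<^sub>v (m + r)"
  shows "weight (cw 0 u) = (q - 1) * q ^ (m + r - 1)"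
proof -
  have "supp (cw 0 u) = {x \<in> V (m + r). u \<bullet> x \<noteq> 0}"
    using assms by (auto simp: supp_def codeword_def coords_def)
  then show ?thesis using card_off_hyperplane_q[OF assms] by (simp add: weight_def)
qed

text \<open>
  Adding \<open>s f\<close> to a functional turns its values \<open>-s\<close> on \<open>D\<close> into \<open>0\<close> and its zeros on \<open>D\<close> into \<open>s\<close>.
\<close>

lemma weight_codeword:
  assumes s: "s \<noteq> 0" and u: "u \<in> V (m + r)"
  shows "weight (cw s u) + card {x \<in> D. u \<bullet> x = - s} =
    card {x \<in> V (m + r). u \<bullet> x \<noteq> 0} + card {x \<in> D. u \<bullet> x = 0}"
proof -
  let ?X = "{x \<in> V (m + r). u \<bullet> x \<noteq> 0}"
  let ?A = "{x \<in> D. u \<bullet> x = - s}" and ?B = "{x \<in> D. u \<bullet> x = 0}"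
  have fin: "finite ?X" "finite ?A" "finite ?B" using finite_D by auto
  have "supp (cw s u) = (?X - ?A) \<union> ?B"
  proof (rule Set.set_eqI)
    fix x
    have "x \<in> D \<Longrightarrow> x \<in> coords (m + r)" using D_subset by auto
    then show "x \<in> supp (cw s u) \<longleftrightarrow> x \<in> (?X - ?A) \<union> ?B"
      using u s by (auto simp: supp_def codeword_def f_coords coords_def eq_neg_iff_add_eq_0 add.commute)
  qed
  moreover have "?A \<subseteq> ?X" using D_subset coords_subset s by auto
  moreover have "(?X - ?A) \<inter> ?B = {}" by auto
  ultimately have "weight (cw s u) = card ?X - card ?A + card ?B" "card ?A \<le> card ?X"
    using fin by (simp_all add: weight_def card_mono card_Diff_subset card_Un_disjoint)
  then show ?thesis by simp
qed

lemma weight_codeword_append: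
  assumes s: "s \<noteq> 0" and a: "a \<in> V m" and b: "b \<in> V r"
  shows "weight (cw s (a @\<^sub>v b)) +
      (card {y \<in> V m - {0\<^sub>v m}. a \<bullet> y = - s} + card {z \<in> V r - {0\<^sub>v r}. b \<bullet> z = \<sigma> a - s}) =
    (if a = 0\<^sub>v m \<and> b = 0\<^sub>v r then 0 else (q - 1) * q ^ (m + r - 1)) +
      (card {y \<in> V m - {0\<^sub>v m}. a \<bullet> y = 0} + card {z \<in> V r - {0\<^sub>v r}. b \<bullet> z = \<sigma> a})"
proof -
  have u: "a @\<^sub>v b \<in> V (m + r)" using a b by simp
  have "card {x \<in> V (m + r). (a @\<^sub>v b) \<bullet> x \<noteq> 0} =
      (if a = 0\<^sub>v m \<and> b = 0\<^sub>v r then 0 else (q - 1) * q ^ (m + r - 1))"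
    using card_off_hyperplane_q[OF u] a by (auto simp: append_eq_zero_iff append_zero_vec)
  then show ?thesis
    using weight_codeword[OF s u] card_D_level[OF a b, of "- s"] card_D_level[OF a b, of 0] by simp
qed

abbreviation Q :: nat where "Q \<equiv> (q - 1) * q ^ (m + r - 1)"

text \<open>
  The cases are exhaustive for \<open>s \<noteq> 0\<close>, and mutually exclusive because \<open>\<sigma> 0 = 0\<close>.
\<close>

lemma weight_table:
  assumes s: "s \<noteq> 0" and a: "a \<in> V m" and b: "b \<in> V r"
  shows "a = 0\<^sub>v m \<Longrightarrow> b = 0\<^sub>v r \<Longrightarrow> weight (cw s (a @\<^sub>v b)) = q ^ m + q ^ r - 2"
    and "a = 0\<^sub>v m \<Longrightarrow> b \<noteq> 0\<^sub>v r \<Longrightarrow> weight (cw s (a @\<^sub>v b)) = Q + q ^ m - 2"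
    and "a \<noteq> 0\<^sub>v m \<Longrightarrow> b = 0\<^sub>v r \<Longrightarrow> \<sigma> a = 0 \<Longrightarrow> weight (cw s (a @\<^sub>v b)) = Q + q ^ r - 2"
    and "b = 0\<^sub>v r \<Longrightarrow> \<sigma> a = s \<Longrightarrow> weight (cw s (a @\<^sub>v b)) = Q - q ^ r"
    and "a \<noteq> 0\<^sub>v m \<Longrightarrow> b \<noteq> 0\<^sub>v r \<Longrightarrow> \<sigma> a = 0 \<Longrightarrow> weight (cw s (a @\<^sub>v b)) = Q - 2"
    and "b \<noteq> 0\<^sub>v r \<Longrightarrow> \<sigma> a = s \<Longrightarrow> weight (cw s (a @\<^sub>v b)) = Q"
    and "\<sigma> a \<noteq> 0 \<Longrightarrow> \<sigma> a \<noteq> s \<Longrightarrow> weight (cw s (a @\<^sub>v b)) = Q - 1"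
proof -
  \<comment> \<open>Naming the powers makes the remaining arithmetic linear.\<close>
  define M M' R R' Z where ns: "M = q ^ m" "M' = q ^ (m - 1)" "R = q ^ r" "R' = q ^ (r - 1)" "Z = Q"
  have pos: "1 \<le> M" "1 \<le> M'" "1 \<le> R" "1 \<le> R'" using card_ge_3 by (auto simp: ns)
  have \<sigma>: "a = 0\<^sub>v m \<Longrightarrow> \<sigma> a = 0" by simp
  note W = weight_codeword_append[OF assms, unfolded card_nonzero_level_q[OF a] card_nonzero_level_q[OF b],
      folded ns]
  show "a = 0\<^sub>v m \<Longrightarrow> b = 0\<^sub>v r \<Longrightarrow> weight (cw s (a @\<^sub>v b)) = q ^ m + q ^ r - 2"
    and "a = 0\<^sub>v m \<Longrightarrow> b \<noteq> 0\<^sub>v r \<Longrightarrow> weight (cw s (a @\<^sub>v b)) = Q + q ^ m - 2"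
    and "a \<noteq> 0\<^sub>v m \<Longrightarrow> b = 0\<^sub>v r \<Longrightarrow> \<sigma> a = 0 \<Longrightarrow> weight (cw s (a @\<^sub>v b)) = Q + q ^ r - 2"
    and "b = 0\<^sub>v r \<Longrightarrow> \<sigma> a = s \<Longrightarrow> weight (cw s (a @\<^sub>v b)) = Q - q ^ r"
    and "a \<noteq> 0\<^sub>v m \<Longrightarrow> b \<noteq> 0\<^sub>v r \<Longrightarrow> \<sigma> a = 0 \<Longrightarrow> weight (cw s (a @\<^sub>v b)) = Q - 2"
    and "b \<noteq> 0\<^sub>v r \<Longrightarrow> \<sigma> a = s \<Longrightarrow> weight (cw s (a @\<^sub>v b)) = Q"
    and "\<sigma> a \<noteq> 0 \<Longrightarrow> \<sigma> a \<noteq> s \<Longrightarrow> weight (cw s (a @\<^sub>v b)) = Q - 1"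
    unfolding ns[symmetric] using W \<sigma> s pos
    by (cases "a = 0\<^sub>v m"; cases "b = 0\<^sub>v r"; simp)+
qed

subsection \<open>Size estimates\<close>

lemma power_bounds:
  shows "q ^ m + q ^ r \<le> 2 * q ^ (m + r - 2)" and "2 * q ^ (m + r - 1) \<le> Q"
    and "q ^ (m + r - 1) = q * q ^ (m + r - 2)" and "3 \<le> q ^ m" and "3 \<le> q ^ r"
proof -
  have le: "q ^ i \<le> q ^ j" if "i \<le> j" for i j using card_ge_3 that by (intro power_increasing) auto
  show "q ^ m + q ^ r \<le> 2 * q ^ (m + r - 2)" 
    using le[of m "m + r - 2"] le[of r "m + r - 2"] m r by linarith
  show "2 * q ^ (m + r - 1) \<le> Q" using card_ge_3 by (intro mult_right_mono) auto
  have "m + r - 1 = Suc (m + r - 2)" using m by simp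
  then show "q ^ (m + r - 1) = q * q ^ (m + r - 2)" by simp
  show "3 \<le> q ^ m" "3 \<le> q ^ r" using le[of 1 m] le[of 1 r] m r card_ge_3 by auto
qed

lemma weight_lower_bound:
  assumes u: "u \<in> V (m + r)" and nz: "s \<noteq> 0 \<or> u \<noteq> 0\<^sub>v (m + r)"
  shows "q ^ m + q ^ r - 2 \<le> weight (cw s u)"
proof -
  obtain a b where ab: "a \<in> V m" "b \<in> V r" "u = a @\<^sub>v b" using u by (rule carrier_vec_appendE)
  have "3 * q ^ (m + r - 2) \<le> q * q ^ (m + r - 2)" using card_ge_3 by (rule mult_right_mono) simp
  with power_bounds have Q: "q ^ m + q ^ r + q ^ r \<le> Q" by linarith
  show ?thesis
  proof (cases "s = 0")
    case True
    then show ?thesis using weight_codeword_0[OF u] nz Q by simp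
  next
    case False
    consider "a = 0\<^sub>v m" "b = 0\<^sub>v r" | "a = 0\<^sub>v m" "b \<noteq> 0\<^sub>v r"
      | "a \<noteq> 0\<^sub>v m" "b = 0\<^sub>v r" "\<sigma> a = 0" | "b = 0\<^sub>v r" "\<sigma> a = s"
      | "a \<noteq> 0\<^sub>v m" "b \<noteq> 0\<^sub>v r" "\<sigma> a = 0" | "b \<noteq> 0\<^sub>v r" "\<sigma> a = s"
      | "\<sigma> a \<noteq> 0" "\<sigma> a \<noteq> s" by blast
    then have "q ^ m + q ^ r - 2 \<le> weight (cw s (a @\<^sub>v b))"
    proof cases
      case 1 show ?thesis using weight_table(1)[OF False ab(1,2) 1] by linarith
    next
      case 2 show ?thesis using weight_table(2)[OF False ab(1,2) 2] Q power_bounds by linarith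
    next
      case 3 show ?thesis using weight_table(3)[OF False ab(1,2) 3] Q power_bounds by linarith
    next
      case 4 show ?thesis using weight_table(4)[OF False ab(1,2) 4] Q by linarith
    next
      case 5 show ?thesis using weight_table(5)[OF False ab(1,2) 5] Q by linarith
    next
      case 6 show ?thesis using weight_table(6)[OF False ab(1,2) 6] Q by linarith
    next
      case 7 show ?thesis using weight_table(7)[OF False ab(1,2) 7] Q by linarith
    qed
    then show ?thesis by (simp add: ab(3))
  qed
qed

lemma card_D_less: "card D < 2 * q ^ (m + r - 2)"
proof -
  have "card D \<le> card (V m - {0\<^sub>v m}) + card (V r - {0\<^sub>v r})"
    unfolding ideal_points_def
    by (rule order.trans[OF card_Un_le add_mono[OF card_image_le card_image_le]]) auto
  also have "\<dots> < q ^ m + q ^ r" using power_bounds by (simp add: card_Diff_subset card_V)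
  finally show ?thesis using power_bounds(1) by linarith
qed

subsection \<open>Linearity, dimension and minimum distance\<close>

lemma cw_add:
  assumes "u \<in> V (m + r)" "u' \<in> V (m + r)"
  shows "cw (s + s') (u + u') = cw s u + cw s' u'"
proof
  fix x
  show "cw (s + s') (u + u') x = (cw s u + cw s' u') x"
    using assms coords_subset
    by (auto simp: codeword_def add_scalar_prod_distrib[of _ "m + r"] algebra_simps)
qed

lemma cw_scale:
  assumes "u \<in> V (m + r)"
  shows "cw (k * s) (k \<cdot>\<^sub>v u) = scale_word k (cw s u)"
proof
  fix x
  show "cw (k * s) (k \<cdot>\<^sub>v u) x = scale_word k (cw s u) x"
    using assms coords_subset by (auto simp: codeword_def scale_word_def algebra_simps)
qed

lemma cw_diff:
  assumes u: "u \<in> V (m + r)" "u' \<in> V (m + r)"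
  shows "cw (s - s') (u - u') = cw s u - cw s' u'"
proof -
  have "cw (s - s' + s') (u - u' + u') = cw (s - s') (u - u') + cw s' u'"
    using u by (intro cw_add) auto
  moreover have "u - u' + u' = u" using u by auto
  ultimately show ?thesis by (simp add: algebra_simps)
qed

lemma cw_eq_0_iff:
  assumes "u \<in> V (m + r)"
  shows "cw s u = 0 \<longleftrightarrow> s = 0 \<and> u = 0\<^sub>v (m + r)"
proof
  assume "cw s u = 0"
  then have "weight (cw s u) = 0" by (simp add: weight_def supp_def)
  then show "s = 0 \<and> u = 0\<^sub>v (m + r)"
    using weight_lower_bound[OF assms, of s] power_bounds(4,5) by linarith
next
  assume "s = 0 \<and> u = 0\<^sub>v (m + r)"
  then show "cw s u = 0" using coords_subset by (auto simp: codeword_def fun_eq_iff)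
qed

lemma cw_inject:
  assumes u: "u \<in> V (m + r)" "u' \<in> V (m + r)"
  shows "cw s u = cw s' u' \<longleftrightarrow> s = s' \<and> u = u'"
proof
  assume "cw s u = cw s' u'"
  then have "cw (s - s') (u - u') = 0" using cw_diff[OF u] by simp
  then have "s - s' = 0" "u - u' = 0\<^sub>v (m + r)" using cw_eq_0_iff[of "u - u'"] u by auto
  moreover have "u - u' + u' = u" using u by auto
  ultimately show "s = s' \<and> u = u'" using u by auto
qed auto

lemma C_eq_image: "C = (\<lambda>(s, u). cw s u) ` (UNIV \<times> V (m + r))"
  by (auto simp: code_of_def)

lemma cw_in_C: "u \<in> V (m + r) \<Longrightarrow> cw s u \<in> C"
  unfolding C_eq_image by force

lemma card_C: "finite C" "card C = q ^ (m + r + 1)"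
proof -
  show "finite C" unfolding C_eq_image by simp
  have "inj_on (\<lambda>(s, u). cw s u) (UNIV \<times> V (m + r))"
    by (rule inj_onI) (auto simp: cw_inject)
  then show "card C = q ^ (m + r + 1)"
    unfolding C_eq_image by (simp add: card_image card_cartesian_product card_V q)
qed

lemma subspace_C: "word.subspace C"
  unfolding word.subspace_def
proof (intro conjI ballI allI)
  have "cw 0 (0\<^sub>v (m + r)) = 0" by (simp add: cw_eq_0_iff)
  then show "0 \<in> C" using cw_in_C[of "0\<^sub>v (m + r)" 0] by simp
next
  fix c c' assume "c \<in> C" "c' \<in> C"
  then obtain s u s' u' where "c = cw s u" "c' = cw s' u'" "u \<in> V (m + r)" "u' \<in> V (m + r)"
    by (auto simp: code_of_def)
  then have "c + c' = cw (s + s') (u + u')" "u + u' \<in> V (m + r)" by (auto simp: cw_add)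
  then show "c + c' \<in> C" by (simp only: cw_in_C)
next
  fix c k assume "c \<in> C"
  then obtain s u where "c = cw s u" "u \<in> V (m + r)" by (auto simp: code_of_def)
  then have "scale_word k c = cw (k * s) (k \<cdot>\<^sub>v u)" "k \<cdot>\<^sub>v u \<in> V (m + r)" by (auto simp: cw_scale)
  then show "scale_word k c \<in> C" by (simp only: cw_in_C)
qed

lemma code_params_C: "code_params (coords (m + r)) C (q ^ (m + r) - 1) (m + r + 1) (q ^ m + q ^ r - 2)"
  unfolding code_params_def
proof (intro conjI)
  show "linear_code (coords (m + r)) C"
    unfolding linear_code_def using subspace_C finite_subset[OF coords_subset finite_carrier_vec]
    by (auto simp: code_of_def words_def codeword_def)
  show "card (coords (m + r) :: 'a vec set) = q ^ (m + r) - 1"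
    by (simp add: coords_def card_Diff_subset card_V)
  have "q ^ word.dim C = q ^ (m + r + 1)"
    using card_subspace[OF subspace_C card_C(1)] card_C(2) by (simp add: q)
  then show "word.dim C = m + r + 1" using card_ge_3 by (subst (asm) power_inject_exp) auto
  show "min_dist C = q ^ m + q ^ r - 2"
  proof (rule min_dist_eqI[OF subspace_C])
    show "cw 1 (0\<^sub>v (m + r)) \<in> C" by (simp add: cw_in_C)
    show "cw 1 (0\<^sub>v (m + r)) \<noteq> 0" by (simp add: cw_eq_0_iff)
    show "weight (cw 1 (0\<^sub>v (m + r))) = q ^ m + q ^ r - 2"
      using weight_table(1)[of 1 "0\<^sub>v m" "0\<^sub>v r"] by (simp add: append_zero_vec)
    fix c assume "c \<in> C" "c \<noteq> 0"
    then show "q ^ m + q ^ r - 2 \<le> weight c"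
      using weight_lower_bound by (fastforce simp: code_of_def cw_eq_0_iff)
  qed
qed

subsection \<open>Minimality\<close>

lemma low_in_D: "a \<in> V m \<Longrightarrow> a \<noteq> 0\<^sub>v m \<Longrightarrow> a @\<^sub>v 0\<^sub>v r \<in> D"
  and high_in_D: "b \<in> V r \<Longrightarrow> b \<noteq> 0\<^sub>v r \<Longrightarrow> vec m (\<lambda>_. - 1) @\<^sub>v b \<in> D"
  unfolding ideal_points_def by blast+

lemma supp_cw_subset_iff:
  "supp (cw s' u') \<subseteq> supp (cw s u) \<longleftrightarrow> (\<forall>x\<in>coords (m + r). s * f x + u \<bullet> x = 0 \<longrightarrow> s' * f x + u' \<bullet> x = 0)"
  by (auto simp: supp_def codeword_def)

text \<open>
  The zeros of a codeword with \<open>s \<noteq> 0\<close> span the whole space: no nonzero functional vanishes on them.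
\<close>

lemma zeros_span:
  assumes s: "s \<noteq> 0" and u: "u \<in> V (m + r)" and w: "w \<in> V (m + r)"
    and zeros: "\<And>x. x \<in> coords (m + r) \<Longrightarrow> s * f x + u \<bullet> x = 0 \<Longrightarrow> w \<bullet> x = 0"
  shows "w = 0\<^sub>v (m + r)"
proof (rule ccontr)
  assume w0: "w \<noteq> 0\<^sub>v (m + r)"
  have bound: "2 * q ^ (m + r - 2) \<le> (q - 1) * q ^ (m + r - 2)" using card_ge_3 by simp
  have off: "w \<bullet> x = 0" if "x \<in> V (m + r)" "x \<notin> D" "u \<bullet> x = 0" for x
    using zeros[of x] that w f_coords by (cases "x = 0\<^sub>v (m + r)") (auto simp: coords_def)
  show False
  proof (cases "u = 0\<^sub>v (m + r)")
    case True
    then have "{x \<in> V (m + r). w \<bullet> x \<noteq> 0} \<subseteq> D" using off by auto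
    then have "(q - 1) * q ^ (m + r - 1) \<le> card D"
      using card_mono[OF finite_D] by (simp only: card_off_hyperplane_q[OF w w0, symmetric])
    moreover have "q ^ (m + r - 2) \<le> q ^ (m + r - 1)" using card_ge_3 by (intro power_increasing) auto
    ultimately show False using card_D_less power_bounds(2) by linarith
  next
    case u0: False
    show False
    proof (cases "\<exists>k. w = k \<cdot>\<^sub>v u")
      case False
      then have "card {x \<in> V (m + r). u \<bullet> x = 0 \<and> w \<bullet> x \<noteq> 0} = (q - 1) * q ^ (m + r - 2)"
        using u u0 w m by (intro card_hyperplane_Diff_q) auto
      moreover have "{x \<in> V (m + r). u \<bullet> x = 0 \<and> w \<bullet> x \<noteq> 0} \<subseteq> D" using off by auto
      ultimately have "(q - 1) * q ^ (m + r - 2) \<le> card D"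
        using card_mono[OF finite_D, of "{x \<in> V (m + r). u \<bullet> x = 0 \<and> w \<bullet> x \<noteq> 0}"] by simp
      then show False using bound card_D_less by linarith
    next
      case True
      then obtain k where k: "w = k \<cdot>\<^sub>v u" by blast
      with w0 have k0: "k \<noteq> 0" using u by auto
      obtain a b where ab: "a \<in> V m" "b \<in> V r" "u = a @\<^sub>v b" using u by (rule carrier_vec_appendE)
      \<comment> \<open>A point of the first part of \<open>D\<close> works if \<open>a \<noteq> 0\<close>, and one of the second part otherwise.\<close>
      have "\<exists>x\<in>D. u \<bullet> x = - s"
      proof (cases "a = 0\<^sub>v m")
        case False
        obtain y where y: "y \<in> V m" "a \<bullet> y = 1" using ex_scalar_prod_eq_1[OF ab(1) False] by blast
        let ?y = "(- s) \<cdot>\<^sub>v y"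
        have ay: "a \<bullet> ?y = - s" using ab(1) y by simp
        have "?y \<noteq> 0\<^sub>v m"
        proof
          assume "?y = 0\<^sub>v m"
          with ay have "a \<bullet> 0\<^sub>v m = - s" by (simp only:)
          then show False using s ab(1) by simp
        qed
        then have "?y @\<^sub>v 0\<^sub>v r \<in> D" using y by (intro low_in_D) auto
        moreover have "u \<bullet> (?y @\<^sub>v 0\<^sub>v r) = - s"
          unfolding ab(3) using ab(1,2) y ay by (subst scalar_prod_append[of _ m _ r]) auto
        ultimately show ?thesis by blast
      next
        case a0: True
        then have "b \<noteq> 0\<^sub>v r" using u0 ab(3) by (auto simp: append_zero_vec)
        then obtain y where y: "y \<in> V r" "b \<bullet> y = 1" using ex_scalar_prod_eq_1[OF ab(2)] by blast
        let ?y = "(- s) \<cdot>\<^sub>v y"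
        have b_y: "b \<bullet> ?y = - s" using ab(2) y by simp
        have "?y \<noteq> 0\<^sub>v r"
        proof
          assume "?y = 0\<^sub>v r"
          with b_y have "b \<bullet> 0\<^sub>v r = - s" by (simp only:)
          then show False using s ab(2) by simp
        qed
        then have "vec m (\<lambda>_. - 1) @\<^sub>v ?y \<in> D" using y by (intro high_in_D) auto
        moreover have "u \<bullet> (vec m (\<lambda>_. - 1) @\<^sub>v ?y) = b \<bullet> ?y"
          unfolding ab(3) a0 using ab(1,2) y by (subst scalar_prod_append[of _ m _ r]) auto
        ultimately show ?thesis using b_y by metis
      qed
      then obtain x where x: "x \<in> D" "u \<bullet> x = - s" by blast
      then have xc: "x \<in> coords (m + r)" "x \<in> V (m + r)" using D_subset coords_subset by auto
      have "s * f x + u \<bullet> x = 0" using x xc by (simp add: f_coords)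
      then have "w \<bullet> x = 0" using zeros xc by blast
      then show False using x s k k0 u xc by simp
    qed
  qed
qed

lemma minimal_code_C: "minimal_code C"
  unfolding minimal_code_def minimal_codeword_def
proof (intro ballI impI conjI)
  fix c c' assume "c \<in> C" "c \<noteq> 0" "c' \<in> C" and sub: "supp c' \<subseteq> supp c"
  then obtain s u s' u' where c: "c = cw s u" "c' = cw s' u'" and u: "u \<in> V (m + r)" "u' \<in> V (m + r)"
    and nz: "s \<noteq> 0 \<or> u \<noteq> 0\<^sub>v (m + r)"
    by (auto simp: code_of_def cw_eq_0_iff)
  have zeros: "s' * f x + u' \<bullet> x = 0" if "x \<in> coords (m + r)" "s * f x + u \<bullet> x = 0" for x
    using sub that unfolding c supp_cw_subset_iff by blast
  show "\<exists>k. c' = scale_word k c"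
  proof (cases "s = 0")
    case False
    let ?k = "s' / s"
    have "u' - ?k \<cdot>\<^sub>v u = 0\<^sub>v (m + r)"
    proof (rule zeros_span[OF False u(1)])
      fix x assume x: "x \<in> coords (m + r)" "s * f x + u \<bullet> x = 0"
      then have "x \<in> V (m + r)" using coords_subset by auto
      then have "(u' - ?k \<cdot>\<^sub>v u) \<bullet> x = (s' * f x + u' \<bullet> x) - ?k * (s * f x + u \<bullet> x)"
        using u False by (subst minus_scalar_prod_distrib[of _ "m + r"]) (auto simp: field_simps)
      then show "(u' - ?k \<cdot>\<^sub>v u) \<bullet> x = 0" using x zeros by simp
    qed (use u in auto)
    moreover have "u' - ?k \<cdot>\<^sub>v u + ?k \<cdot>\<^sub>v u = u'" using u by auto
    ultimately have "u' = ?k \<cdot>\<^sub>v u" using u by auto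
    then have "c' = scale_word ?k c" using cw_scale[OF u(1), of ?k s] c False by simp
    then show ?thesis by blast
  next
    case s: True
    then have u0: "u \<noteq> 0\<^sub>v (m + r)" using nz by simp
    \<comment> \<open>A nonzero \<open>y\<close> with \<open>a \<bullet> y = 0\<close> exists since \<open>m \<ge> 2\<close>. At its multiples \<open>j y\<close> with \<open>j \<noteq> 0\<close> the function
      \<open>f\<close> is \<open>1\<close>, so \<open>s' + j (u' \<bullet> y) = 0\<close> for the two values \<open>j = 1\<close> and \<open>j = k\<close>.\<close>
    have "s' = 0"
    proof (rule ccontr)
      assume s': "s' \<noteq> 0"
      obtain a b where ab: "a \<in> V m" "b \<in> V r" "u = a @\<^sub>v b" using u(1) by (rule carrier_vec_appendE)
      have "{y \<in> V m. a \<bullet> y = 0} \<noteq> {0\<^sub>v m}"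
      proof
        assume eq: "{y \<in> V m. a \<bullet> y = 0} = {0\<^sub>v m}"
        have "q ^ 1 \<le> q ^ (m - 1)" "q ^ 1 \<le> q ^ m"
          using m card_ge_3 by (intro power_increasing; simp)+
        moreover have "card {y \<in> V m. a \<bullet> y = 0} = (if a = 0\<^sub>v m then q ^ m else q ^ (m - 1))"
        proof (cases "a = 0\<^sub>v m")
          case True
          then have all: "{y \<in> V m. a \<bullet> y = 0} = V m" by auto
          show ?thesis unfolding all card_V using True by (rule if_P[symmetric])
        next
          case False
          then show ?thesis unfolding card_hyperplane_q[OF ab(1) False] by (rule if_not_P[symmetric])
        qed
        ultimately have "q ^ 1 \<le> card {y \<in> V m. a \<bullet> y = 0}" by presburger
        also have "\<dots> = 1" unfolding eq by simp
        finally show False using card_ge_3 by simp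
      qed
      moreover have "0\<^sub>v m \<in> {y \<in> V m. a \<bullet> y = 0}" using ab by simp
      ultimately obtain y where y: "y \<in> V m" "a \<bullet> y = 0" "y \<noteq> 0\<^sub>v m" by blast
      have "\<not> UNIV \<subseteq> {0, 1 :: 'a}"
        using card_mono[of "{0, 1 :: 'a}" UNIV] card_ge_3 q by auto
      then obtain k :: 'a where k: "k \<noteq> 0" "k \<noteq> 1" by auto
      have val: "s' + j * (u' \<bullet> (y @\<^sub>v 0\<^sub>v r)) = 0" if "j \<noteq> 0" for j
      proof -
        let ?x = "(j \<cdot>\<^sub>v y) @\<^sub>v 0\<^sub>v r"
        have "j \<cdot>\<^sub>v y \<noteq> 0\<^sub>v m"
        proof
          assume "j \<cdot>\<^sub>v y = 0\<^sub>v m"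
          moreover have "inverse j \<cdot>\<^sub>v 0\<^sub>v m = 0\<^sub>v m" by (rule eq_vecI) auto
          ultimately have "inverse j \<cdot>\<^sub>v (j \<cdot>\<^sub>v y) = 0\<^sub>v m" by (simp only:)
          then show False using y(3) that by (simp add: smult_smult_assoc)
        qed
        then have xD: "?x \<in> D" using y by (intro low_in_D) auto
        have "u \<bullet> ?x = 0"
          unfolding ab(3) using ab y by (subst scalar_prod_append[of _ m _ r]) auto
        then have "s' + u' \<bullet> ?x = 0" using zeros[of ?x] xD D_subset s by (auto simp: f_coords)
        moreover have "?x = j \<cdot>\<^sub>v (y @\<^sub>v 0\<^sub>v r)" using y by (intro eq_vecI) auto
        ultimately show ?thesis using u y by simp
      qed
      have "(k - 1) * (u' \<bullet> (y @\<^sub>v 0\<^sub>v r)) =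
          (s' + k * (u' \<bullet> (y @\<^sub>v 0\<^sub>v r))) - (s' + 1 * (u' \<bullet> (y @\<^sub>v 0\<^sub>v r)))"
        by (simp add: algebra_simps)
      then have "(k - 1) * (u' \<bullet> (y @\<^sub>v 0\<^sub>v r)) = 0" unfolding val[OF k(1)] val[OF one_neq_zero] by simp
      then show False using val[of 1] k s' by simp
    qed
    have "\<exists>k. u' = k \<cdot>\<^sub>v u"
    proof (rule ccontr)
      assume "\<nexists>k. u' = k \<cdot>\<^sub>v u"
      then obtain x where x: "x \<in> V (m + r)" "u \<bullet> x = 0" "u' \<bullet> x = 1"
        using ex_scalar_prod_eq_0_1[OF u(1) u0 u(2)] by metis
      then have "x \<in> coords (m + r)" using u by (auto simp: coords_def)
      then show False using zeros[of x] x s \<open>s' = 0\<close> by simp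
    qed
    then obtain k where "u' = k \<cdot>\<^sub>v u" by blast
    then have "c' = scale_word k c" using cw_scale[OF u(1), of k 0] c s \<open>s' = 0\<close> by simp
    then show ?thesis by blast
  qed
qed auto

subsection \<open>Weight distribution\<close>

text \<open>
  The nonzero scalars, and the vectors of coordinate sum \<open>t\<close>.
\<close>

abbreviation S :: "'a set" where "S \<equiv> UNIV - {0}"
abbreviation A :: "'a \<Rightarrow> 'a vec set" where "A t \<equiv> {a \<in> V m. \<sigma> a = t}"

lemma card_S: "card S = q - 1"
  by (simp add: card_Diff_subset q)

lemma card_A: "card (A t) = q ^ (m - 1)"
proof (rule card_hyperplane_q)
  have "vec m (\<lambda>_. 1) $ 0 \<noteq> (0\<^sub>v m :: 'a vec) $ 0" using m by simp
  then show "vec m (\<lambda>_. 1) \<noteq> (0\<^sub>v m :: 'a vec)" by metis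
qed simp

lemma card_A_0: "card (A 0 - {0\<^sub>v m}) = q ^ (m - 1) - 1"
  using card_A[of 0] by (subst card_Diff_subset) auto

lemma card_A_compl:
  assumes "s \<noteq> 0"
  shows "card (V m - (A 0 \<union> A s)) = (q - 2) * q ^ (m - 1)"
proof -
  have fin: "finite (A t)" for t by (rule finite_subset[OF _ finite_carrier_vec[of m]]) auto
  have "card (A 0 \<union> A s) = card (A 0) + card (A s)"
    using assms fin by (intro card_Un_disjoint) auto
  then have "card (V m - (A 0 \<union> A s)) = q ^ m - 2 * q ^ (m - 1)"
    using fin by (subst card_Diff_subset) (auto simp: card_V card_A)
  moreover have "q ^ m = q * q ^ (m - 1)" using m by (cases m) auto
  ultimately show ?thesis by (simp add: diff_mult_distrib)
qed

lemma card_V_0: "card (V r - {0\<^sub>v r}) = q ^ r - 1"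
  by (subst card_Diff_subset) (auto simp: card_V)

text \<open>
  The parameters \<open>(s, a, b)\<close> of the nonzero codewords \<open>c(s, (a, b))\<close>, partitioned by the case that
  determines the weight; the class of weight \<open>Q\<close> also contains the linear functionals (\<open>s = 0\<close>).
\<close>

definition weight_classes :: "(nat \<times> ('a \<times> 'a vec \<times> 'a vec) set) list" where
  "weight_classes =
    [(q ^ m + q ^ r - 2, S \<times> {0\<^sub>v m} \<times> {0\<^sub>v r}),
     (Q - q ^ r, SIGMA s:S. A s \<times> {0\<^sub>v r}),
     (Q - 2, S \<times> (A 0 - {0\<^sub>v m}) \<times> (V r - {0\<^sub>v r})),
     (Q - 1, SIGMA s:S. (V m - (A 0 \<union> A s)) \<times> V r),
     (Q, {0} \<times> (V m \<times> V r - {(0\<^sub>v m, 0\<^sub>v r)}) \<union> (SIGMA s:S. A s \<times> (V r - {0\<^sub>v r}))),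
     (Q + q ^ m - 2, S \<times> {0\<^sub>v m} \<times> (V r - {0\<^sub>v r})),
     (Q + q ^ r - 2, S \<times> (A 0 - {0\<^sub>v m}) \<times> {0\<^sub>v r})]"

lemma weight_classes_disjoint: "sorted_wrt (\<lambda>x y. snd x \<inter> snd y = {}) weight_classes"
  unfolding weight_classes_def by (simp; auto)

lemma weight_classes_finite: "(w, K) \<in> set weight_classes \<Longrightarrow> finite K"
  unfolding weight_classes_def
  by (rule finite_subset[of _ "UNIV \<times> V m \<times> V r"]) auto

lemma weight_classes_weight:
  assumes "(w, K) \<in> set weight_classes" "(s, a, b) \<in> K"
  shows "weight (cw s (a @\<^sub>v b)) = w"
proof -
  have a0: "0\<^sub>v m \<in> V m" "0\<^sub>v r \<in> V r" by auto
  have zero: "weight (cw 0 (a @\<^sub>v b)) = Q"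
    if "a \<in> V m" "b \<in> V r" "a \<noteq> 0\<^sub>v m \<or> b \<noteq> 0\<^sub>v r"
    using that by (intro weight_codeword_0) (auto simp: append_eq_zero_iff)
  show ?thesis
    using assms a0 zero weight_table[of s a b] unfolding weight_classes_def by (auto simp del: One_nat_def)
qed

lemma weight_classes_Union: "(\<Union>(w, K) \<in> set weight_classes. K) = UNIV \<times> V m \<times> V r - {(0, 0\<^sub>v m, 0\<^sub>v r)}"
proof (intro equalityI subsetI)
  fix x assume "x \<in> UNIV \<times> V m \<times> V r - {(0 :: 'a, 0\<^sub>v m, 0\<^sub>v r)}"
  then obtain s a b where "x = (s, a, b)" "a \<in> V m" "b \<in> V r" "(s, a, b) \<noteq> (0, 0\<^sub>v m, 0\<^sub>v r)" by auto
  then show "x \<in> (\<Union>(w, K) \<in> set weight_classes. K)"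
    unfolding weight_classes_def
    by (cases "s = 0"; cases "a = 0\<^sub>v m"; cases "b = 0\<^sub>v r"; auto)
next
  fix x assume "x \<in> (\<Union>(w, K) \<in> set weight_classes. K)"
  then show "x \<in> UNIV \<times> V m \<times> V r - {(0, 0\<^sub>v m, 0\<^sub>v r)}"
    unfolding weight_classes_def by auto
qed

lemma weight_classes_card:
  "map (map_prod id card) weight_classes =
    [(q ^ m + q ^ r - 2, q - 1),
     (Q - q ^ r, (q - 1) * q ^ (m - 1)),
     (Q - 2, (q - 1) * (q ^ (m - 1) - 1) * (q ^ r - 1)),
     (Q - 1, (q - 1) * (q - 2) * q ^ (m + r - 1)),
     (Q, q ^ (m + r) - 1 + (q - 1) * q ^ (m - 1) * (q ^ r - 1)),
     (Q + q ^ m - 2, (q - 1) * (q ^ r - 1)),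
     (Q + q ^ r - 2, (q - 1) * (q ^ (m - 1) - 1))]"
proof -
  have fin: "finite (A t)" for t by (rule finite_subset[OF _ finite_carrier_vec[of m]]) auto
  have 1: "card (S \<times> {0\<^sub>v m :: 'a vec} \<times> {0\<^sub>v r :: 'a vec}) = q - 1"
    by (simp only: card_cartesian_product card_S) simp
  have 2: "card (SIGMA s:S. A s \<times> {0\<^sub>v r :: 'a vec}) = (q - 1) * q ^ (m - 1)"
    using fin by (subst card_SigmaI) (auto simp: card_cartesian_product card_A card_S[simplified])
  have 3: "card (S \<times> (A 0 - {0\<^sub>v m}) \<times> (V r - {0\<^sub>v r})) = (q - 1) * (q ^ (m - 1) - 1) * (q ^ r - 1)"
    by (simp only: card_cartesian_product card_S card_A_0 card_V_0 mult.assoc)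
  have e: "q ^ (m - 1) * q ^ r = q ^ (m + r - 1)" using m by (simp flip: power_add)
  have "card (SIGMA s:S. (V m - (A 0 \<union> A s)) \<times> V r) = (\<Sum>s\<in>S. card ((V m - (A 0 \<union> A s)) \<times> V r))"
    by (rule card_SigmaI) auto
  also have "\<dots> = (\<Sum>s\<in>S. (q - 2) * q ^ (m - 1) * q ^ r)"
  proof (rule sum.cong[OF refl])
    fix s assume "s \<in> S"
    then have "s \<noteq> 0" by simp
    from card_A_compl[OF this]
    show "card ((V m - (A 0 \<union> A s)) \<times> V r) = (q - 2) * q ^ (m - 1) * q ^ r"
      by (simp only: card_cartesian_product card_V)
  qed
  also have "\<dots> = (q - 1) * (q - 2) * q ^ (m + r - 1)"
    by (simp only: sum_constant card_S of_nat_id mult.assoc e)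
  finally have 4: "card (SIGMA s:S. (V m - (A 0 \<union> A s)) \<times> V r) = (q - 1) * (q - 2) * q ^ (m + r - 1)" .
  have "card (SIGMA s:S. A s \<times> (V r - {0\<^sub>v r})) = (\<Sum>s\<in>S. card (A s \<times> (V r - {0\<^sub>v r})))"
    using fin by (intro card_SigmaI) auto
  also have "\<dots> = (q - 1) * q ^ (m - 1) * (q ^ r - 1)"
    by (simp only: card_cartesian_product card_A card_V_0 sum_constant card_S of_nat_id mult.assoc)
  finally have 5: "card (SIGMA s:S. A s \<times> (V r - {0\<^sub>v r})) = (q - 1) * q ^ (m - 1) * (q ^ r - 1)" .
  have 6: "card ({0 :: 'a} \<times> (V m \<times> V r - {(0\<^sub>v m, 0\<^sub>v r)})) = q ^ (m + r) - 1"
    by (subst card_cartesian_product, subst card_Diff_subset)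
      (auto simp: card_cartesian_product card_V power_add)
  have 7: "card ({0 :: 'a} \<times> (V m \<times> V r - {(0\<^sub>v m, 0\<^sub>v r)}) \<union> (SIGMA s:S. A s \<times> (V r - {0\<^sub>v r}))) =
      q ^ (m + r) - 1 + (q - 1) * q ^ (m - 1) * (q ^ r - 1)"
    unfolding 5[symmetric] 6[symmetric] using fin by (intro card_Un_disjoint finite_SigmaI) auto
  have 8: "card (S \<times> {0\<^sub>v m :: 'a vec} \<times> (V r - {0\<^sub>v r})) = (q - 1) * (q ^ r - 1)"
    by (simp only: card_cartesian_product card_S card_V_0) simp
  have 9: "card (S \<times> (A 0 - {0\<^sub>v m}) \<times> {0\<^sub>v r :: 'a vec}) = (q - 1) * (q ^ (m - 1) - 1)"
    by (simp only: card_cartesian_product card_S card_A_0) simp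
  show ?thesis
    unfolding weight_classes_def by (simp only: list.map map_prod_simp id_apply 1 2 3 4 7 8 9)
qed

lemma weight_distribution_C: "has_weight_distribution C (map (map_prod id card) weight_classes)"
  unfolding has_weight_distribution_def
proof
  fix w
  let ?P = "UNIV \<times> V m \<times> V r - {(0 :: 'a, 0\<^sub>v m, 0\<^sub>v r)}"
  let ?\<phi> = "\<lambda>(s, a, b). cw s (a @\<^sub>v b)"
  have inj: "inj_on ?\<phi> ?P"
  proof (rule inj_onI)
    fix x y assume xy: "x \<in> ?P" "y \<in> ?P" "?\<phi> x = ?\<phi> y"
    obtain s a b s' a' b' where sab: "x = (s, a, b)" "y = (s', a', b')" by (metis prod_cases3)
    have V: "a \<in> V m" "b \<in> V r" "a' \<in> V m" "b' \<in> V r" using xy by (auto simp: sab)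
    have "cw s (a @\<^sub>v b) = cw s' (a' @\<^sub>v b')" using xy(3) by (simp add: sab)
    then have "s = s' \<and> a @\<^sub>v b = a' @\<^sub>v b'" using V by (subst cw_inject[symmetric]) auto
    then show "x = y" using append_vec_inject[OF V(1,3)] by (simp add: sab)
  qed
  have img: "{c \<in> C. c \<noteq> 0 \<and> weight c = w} = ?\<phi> ` {x \<in> ?P. weight (?\<phi> x) = w}"
  proof (intro equalityI subsetI)
    fix c assume "c \<in> {c \<in> C. c \<noteq> 0 \<and> weight c = w}"
    then obtain s u where c: "c = cw s u" "u \<in> V (m + r)" "c \<noteq> 0" "weight c = w" by (auto simp: code_of_def)
    obtain a b where ab: "a \<in> V m" "b \<in> V r" "u = a @\<^sub>v b" using c(2) by (rule carrier_vec_appendE)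
    have "(s, a, b) \<noteq> (0, 0\<^sub>v m, 0\<^sub>v r)" using c ab by (auto simp: cw_eq_0_iff append_zero_vec)
    then show "c \<in> ?\<phi> ` {x \<in> ?P. weight (?\<phi> x) = w}"
      using c ab by (intro image_eqI[where x = "(s, a, b)"]) auto
  next
    fix c assume "c \<in> ?\<phi> ` {x \<in> ?P. weight (?\<phi> x) = w}"
    then obtain s a b where c: "c = cw s (a @\<^sub>v b)" "a \<in> V m" "b \<in> V r" "weight c = w"
      "(s, a, b) \<noteq> (0, 0\<^sub>v m, 0\<^sub>v r)" by auto
    then have "a @\<^sub>v b \<in> V (m + r)" "\<not> (s = 0 \<and> a @\<^sub>v b = 0\<^sub>v (m + r))"
      by (auto simp: append_eq_zero_iff)
    then show "c \<in> {c \<in> C. c \<noteq> 0 \<and> weight c = w}" using c(1,4) by (simp add: cw_in_C cw_eq_0_iff)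
  qed
  have "inj_on ?\<phi> {x \<in> ?P. weight (?\<phi> x) = w}" using inj by (rule inj_on_subset) auto
  then have "card {c \<in> C. c \<noteq> 0 \<and> weight c = w} = card {x \<in> ?P. weight (?\<phi> x) = w}"
    unfolding img by (rule card_image)
  also have "\<dots> = (\<Sum>(w', K)\<leftarrow>weight_classes. if w' = w then card K else 0)"
    unfolding weight_classes_Union[symmetric]
    by (rule card_weight_classes[OF weight_classes_disjoint]) (use weight_classes_finite weight_classes_weight in fastforce)
  also have "\<dots> = (\<Sum>(w', a)\<leftarrow>map (map_prod id card) weight_classes. if w' = w then a else 0)"
    by (simp only: map_map) (rule arg_cong[of _ _ sum_list], rule map_cong, auto)
  finally show "card {c \<in> C. c \<noteq> 0 \<and> weight c = w} =
    (\<Sum>(w', a)\<leftarrow>map (map_prod id card) weight_classes. if w' = w then a else 0)" .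
qed

lemma card_nonzero_weights_C: "card (nonzero_weights C) \<le> 7"
proof -
  let ?T = "map (map_prod id card) weight_classes"
  have "card (nonzero_weights C) \<le> card (set (map fst ?T))"
    using has_weight_distribution_nonzero_weights[OF weight_distribution_C card_C(1)]
    by (intro card_mono) auto
  also have "\<dots> \<le> length (map fst ?T)" by (rule card_length)
  also have "\<dots> = 7" by (simp add: weight_classes_def)
  finally show ?thesis .
qed

subsection \<open>The Ashikhmin--Barg condition\<close>

lemma not_ashikhmin_barg_C: "\<not> ashikhmin_barg C"
proof -
  let ?W = "nonzero_weights C" and ?d = "q ^ m + q ^ r - 2"
  have fin: "finite ?W" using card_C by (simp add: nonzero_weights_def)
  have wt: "weight (cw s u) \<in> ?W" if "u \<in> V (m + r)" "s \<noteq> 0 \<or> u \<noteq> 0\<^sub>v (m + r)" for s u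
    unfolding nonzero_weights_def using that by (auto simp: cw_in_C cw_eq_0_iff)
  have "?d \<in> ?W"
    using wt[of "0\<^sub>v (m + r)" 1] weight_table(1)[of 1 "0\<^sub>v m" "0\<^sub>v r"] by (simp add: append_zero_vec)
  then have Min: "Min ?W \<le> ?d" using fin by simp
  have u: "unit_vec (m + r) 0 \<in> V (m + r)" "unit_vec (m + r) 0 \<noteq> 0\<^sub>v (m + r)"
    using m by (auto dest: arg_cong[of _ _ "\<lambda>v. v $ 0"])
  then have "Q \<in> ?W" using wt[OF u(1), of 0] weight_codeword_0[OF u] by simp
  then have Max: "Q \<le> Max ?W" using fin by simp
  have "q * ?d \<le> q * (2 * q ^ (m + r - 2))" using power_bounds(1) by (intro mult_left_mono) auto
  also have "\<dots> = 2 * q ^ (m + r - 1)" by (simp only: power_bounds(3) mult.left_commute)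
  also have "\<dots> \<le> Q" by (rule power_bounds(2))
  also have "Q = 1 * Q" by simp
  also have "\<dots> \<le> (q - 1) * Q" by (rule mult_right_mono) (use card_ge_3 in auto)
  finally have dQ: "q * ?d \<le> (q - 1) * Q" .
  have pos: "Q > 0" using card_ge_3 by simp
  have "real (Min ?W) / real (Max ?W) \<le> real ?d / real Q"
  proof (rule frac_le)
    show "real (Min ?W) \<le> real ?d" using Min by (simp only: of_nat_le_iff)
    show "real Q \<le> real (Max ?W)" using Max by (simp only: of_nat_le_iff)
    show "0 < real Q" using pos by (simp only: of_nat_0_less_iff)
  qed simp
  also have "\<dots> \<le> real (q - 1) / real q"
  proof -
    have "real (q * ?d) \<le> real ((q - 1) * Q)" using dQ by (simp only: of_nat_le_iff)
    then have "real q * real ?d \<le> real (q - 1) * real Q" by (simp only: of_nat_mult)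
    then show ?thesis using pos card_ge_3 by (simp add: divide_simps mult.commute)
  qed
  finally show ?thesis using card_ge_3 by (simp add: ashikhmin_barg_def q of_nat_diff not_less)
qed

end

section \<open>The code of the full saturated ideal\<close>

theorem theorem5p4:
  fixes p n m r Q :: nat
    and I :: "nat multiset"
    and f :: "'p::prime_card mod_ring vec \<Rightarrow> 'p mod_ring"
  assumes p: "p = CARD('p)" "odd p"
    and n: "n \<ge> 4"
    and m: "2 \<le> m" "m \<le> n - 2"
    and r: "r = n - m"
    and I: "saturated_ideal p {0..<n} (hier m n) I" "\<forall>i\<in>{0..<n}. count I i = p - 1"
    and f: "\<forall>x\<in>carrier_vec n. f x = indicator (saturated_subideals n (hier m n) I - {0\<^sub>v n}) x"
    and Q: "Q = (p - 1) * p ^ (n - 1)"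
  shows "code_params (coords n) (code_of n f) (p ^ n - 1) (n + 1) (p ^ m + p ^ r - 2) \<and>
    minimal_code (code_of n f) \<and>
    card (nonzero_weights (code_of n f)) \<le> 7 \<and>
    \<not> ashikhmin_barg (code_of n f) \<and>
    has_weight_distribution (code_of n f)
      [(p ^ m + p ^ r - 2, p - 1),
       (Q - p ^ r, (p - 1) * p ^ (m - 1)),
       (Q - 2, (p - 1) * (p ^ (m - 1) - 1) * (p ^ r - 1)),
       (Q - 1, (p - 1) * (p - 2) * p ^ (n - 1)),
       (Q, p ^ n - 1 + (p - 1) * p ^ (m - 1) * (p ^ r - 1)),
       (Q + p ^ m - 2, (p - 1) * (p ^ r - 1)),
       (Q + p ^ r - 2, (p - 1) * (p ^ (m - 1) - 1))]"
proof -
  have n_eq: "n = m + r" and r2: "2 \<le> r" using n m r by auto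
  have "prime p" unfolding p(1) by (rule prime_card)
  then have p3: "3 \<le> p" using p(2) prime_ge_2_nat[of p] by (cases "p = 2") auto
  have D: "saturated_subideals n (hier m n) I - {0\<^sub>v n} = (ideal_points m r :: 'p mod_ring vec set)"
    unfolding n_eq by (rule saturated_subideals_full) (use I m in \<open>auto simp: p n_eq\<close>)
  interpret ideal_code p m r f
    by unfold_locales (use p p3 m r2 f D n_eq in auto)
  show ?thesis
    unfolding n_eq Q using code_params_C minimal_code_C card_nonzero_weights_C not_ashikhmin_barg_C
      weight_distribution_C[unfolded weight_classes_card]
    by blast
qed

end
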